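(* Let $\mu_0=\mathcal N(0,\mathcal C)$ be a centred Gaussian measure on a Hilbert space $H$ and let $(X,\|\cdot\|_X)$ be a Banach space, $X\subseteq H$, with $\mu_0(X)=1$. Let $\Phi:X\to\mathbb R$ and $\Phi^N:X\to\mathbb R$ ($N\in\mathbb N$) be measurable and satisfy the following two conditions, with constants uniform in $N$: (i) for every $\epsilon>0$ there is $M=M(\epsilon)\in\mathbb R$ such that for all $u\in X$ and all $N$, $\Phi(u)\ge M-\epsilon\|u\|_X^2$ and $\Phi^N(u)\ge M-\epsilon\|u\|_X^2$; (ii) for every $r>0$ there is $L=L(r)>0$ such that for all $u\in X$ with $\|u\|_X<r$ and all $N$, $\Phi(u)\le L(r)$ and $\Phi^N(u)\le L(r)$. Assume also that for any $R>0$ there is $K=K(R)>0$ such that, for all $u$ with $\|u\|_X\le R$ and all $N$, $$|\Phi(u)-\Phi^N(u)|\le K\psi(N),$$ where $\psi(N)\to0$ as $N\to\infty$. Define probability measures $\mu,\mu^N$ on $X$ by $$\frac{d\mu}{d\mu_0}(u)=\frac1Z\exp(-\Phi(u)),\quad Z=\int_X\exp(-\Phi(u))\,d\mu_0(u),\qquad \frac{d\mu^N}{d\mu_0}(u)=\frac1{Z^N}\exp(-\Phi^N(u)),\quad Z^N=\int_X\exp(-\Phi^N(u))\,d\mu_0(u).$$ Then $$d_{\rm Hell}(\mu,\mu^N)\to0\quad\text{as }N\to\infty.$$ Consequently all moments of $\|u\|_X$ under $\mu^N$ converge to the corresponding moments under $\mu$ as $N\to\infty$. In particular the mean of $\mu^N$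 converges to the mean of $\mu$ in $X$ and, in the case where $X$ is a Hilbert space, the covariance operator of $\mu^N$ converges to that of $\mu$ in operator norm.
   Context: The Hellinger distance between probability measures $\mu,\mu'$ both absolutely continuous with respect to a reference measure $\nu$ is $$d_{\rm Hell}(\mu,\mu')=\Bigl(\tfrac12\int\Bigl(\sqrt{\tfrac{d\mu}{d\nu}}-\sqrt{\tfrac{d\mu'}{d\nu}}\Bigr)^2d\nu\Bigr)^{1/2},$$ which does not depend on the choice of $\nu$. Standing conventions: $H$ and $X$ are separable, $X$ is continuously embedded in $H$, so $\mu_0$ is regarded as a Gaussian measure on $X$ and Fernique's theorem applies (there is $a>0$ with $\int_X\exp(a\|u\|_X^2)\,d\mu_0(u)<\infty$). *)

theory Defs
  imports "HOL-Probability.Probability"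
begin

definition normal_law :: "real \<Rightarrow> real \<Rightarrow> real measure" where
  "normal_law m v =
     (if v = 0 then return borel m
      else density lborel (\<lambda>x. ennreal (normal_density m (sqrt v) x)))"

text \<open>
  The Gaussian measure \<open>N(0, C)\<close> on a separable real Hilbert space, possibly degenerate. That
  \<open>C\<close> is trace class is a consequence and is not part of the definition.
\<close>

definition centred_gaussian ::
    "('h :: {real_inner, complete_space, second_countable_topology} \<Rightarrow> 'h) \<Rightarrow> 'h measure \<Rightarrow> bool" where
  "centred_gaussian C \<mu> \<longleftrightarrow>
     sets \<mu> = sets borel \<and> prob_space \<mu> \<and>
     bounded_linear C \<and> (\<forall>h k. C h \<bullet> k = h \<bullet> C k) \<and> (\<forall>h. 0 \<le> C h \<bullet> h) \<and>
     (\<forall>h. distr \<mu> borel (\<lambda>x. x \<bullet> h) = normal_law 0 (C h \<bullet> h))"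

text \<open>
  A measure on \<open>H\<close> regarded as a Borel measure on the space \<open>X\<close> embedded in \<open>H\<close> by \<open>j\<close>. If \<open>j\<close> is
  continuous and injective and \<open>X\<close> is separable and complete, then \<open>j ` A\<close> is Borel for every Borel
  set \<open>A\<close> (Lusin--Souslin), so the set function below is a measure.
\<close>

definition measure_on_subspace ::
    "('x :: topological_space \<Rightarrow> 'h) \<Rightarrow> 'h measure \<Rightarrow> 'x measure" where
  "measure_on_subspace j \<mu> = measure_of UNIV (sets borel) (\<lambda>A. emeasure \<mu> (j ` A))"

definition normalising_constant :: "'x measure \<Rightarrow> ('x \<Rightarrow> real) \<Rightarrow> real" where
  "normalising_constant \<mu>0 \<Phi> = (\<integral>u. exp (- \<Phi> u) \<partial>\<mu>0)"

definition posterior :: "'x measure \<Rightarrow> ('x \<Rightarrow> real) \<Rightarrow> 'x measure" where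
  "posterior \<mu>0 \<Phi> =
     density \<mu>0 (\<lambda>u. ennreal (1 / normalising_constant \<mu>0 \<Phi> * exp (- \<Phi> u)))"

text \<open>
  The first argument is the reference measure; it is meant to be sigma-finite and to dominate the
  other two. The library's \<open>RN_deriv \<nu> \<mu>\<close> is \<open>d\<mu>/d\<nu>\<close>.
\<close>

definition hellinger_dist :: "'a measure \<Rightarrow> 'a measure \<Rightarrow> 'a measure \<Rightarrow> real" where
  "hellinger_dist \<nu> \<mu> \<mu>' =
     sqrt (1 / 2 * (\<integral>u. (sqrt (enn2real (RN_deriv \<nu> \<mu> u)) - sqrt (enn2real (RN_deriv \<nu> \<mu>' u)))\<^sup>2 \<partial>\<nu>))"

definition mean :: "'x :: {banach, second_countable_topology} measure \<Rightarrow> 'x" where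
  "mean \<mu> = (\<integral>u. u \<partial>\<mu>)"

text \<open>
  A Banach space is a Hilbert space if some inner product \<open>ip\<close> induces its norm. The inner product
  is an explicit argument because the underlying type need not be an instance of \<open>real_inner\<close>.
\<close>

definition inner_product_of_norm :: "('x :: real_normed_vector \<Rightarrow> 'x \<Rightarrow> real) \<Rightarrow> bool" where
  "inner_product_of_norm ip \<longleftrightarrow>
     (\<forall>u. linear (ip u)) \<and> (\<forall>u v. ip u v = ip v u) \<and> (\<forall>u. ip u u = (norm u)\<^sup>2)"

definition covariance_op ::
    "('x \<Rightarrow> 'x \<Rightarrow> real) \<Rightarrow> 'x :: {banach, second_countable_topology} measure \<Rightarrow> 'x \<Rightarrow> 'x" where
  "covariance_op ip \<mu> v = (\<integral>u. ip (u - mean \<mu>) v *\<^sub>R (u - mean \<mu>) \<partial>\<mu>)"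

end

theory Submission imports Defs begin

text \<open>
  All densities are dominated by \<open>exp (\<epsilon> * (norm u)\<^sup>2)\<close> up to constants, and the potentials converge pointwise,
  so dominated convergence gives \<open>L\<^sup>1\<close> convergence of the densities with any polynomial weight. This needs
  only that \<open>exp (a * (norm u)\<^sup>2)\<close> is integrable for some \<open>a > 0\<close>, that is, Fernique's theorem in the
  norm of \<open>X\<close>. Hellinger distance, moments, mean and covariance are then bounded by weighted \<open>L\<^sup>1\<close>
  distances of the densities, using \<open>(sqrt p - sqrt q)\<^sup>2 \<le> \<bar>p - q\<bar>\<close> for the first.

  Fernique's argument uses only that the product measure is invariant under rotation by 45 degrees. On \<open>H\<close> this
  follows by comparing characteristic functions; it passes to \<open>X\<close> because the embedding is linear and maps
  Borel sets to Borel sets.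
\<close>

section \<open>Injective continuous images of Borel sets\<close>

text \<open>Two topologies shape the proof. The Gaussian property of \<open>\<mu>H\<close> is stated
  through functionals on \<open>H\<close>, whereas exponential integrability is wanted in the norm
  of \<open>X\<close>, which need not be continuous for the topology of \<open>H\<close>. So neither
  a covariance nor a density is carried over to \<open>X\<close>, but a symmetry, and this at the
  level of sets: images of rectangles under the embedding are rectangles, provided that images of
  Borel sets are Borel. The same fact makes \<open>measure_on_subspace\<close> meaningful:
  \<open>measure_of\<close> falls back to the zero measure when its set function is not countably
  additive, and \<open>emeasure\<close> is 0 on sets that are not measurable. The Fernique exponent
  \<open>a\<close> is spent in two halves. The lower bound on the potentials is taken with
  \<epsilon> = \<open>a / 2\<close>, which bounds the unnormalised densities by
  \<open>exp (a / 2 * (norm u)\<^sup>2 - M)\<close>; the other half pays for polynomial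
  weights.\<close>

definition borel_separated :: "'a::topological_space set \<Rightarrow> 'a set \<Rightarrow> bool" where
  "borel_separated A B \<longleftrightarrow> (\<exists>S \<in> sets borel. A \<subseteq> S \<and> S \<inter> B = {})"

text \<open>If \<open>S i k\<close> separates \<open>A i\<close> from \<open>B k\<close>, the union
  over \<open>i\<close> of the intersections over \<open>k\<close> separates the unions. The
  contrapositive is what gets used: when two countable unions cannot be separated, some pair of
  pieces cannot be either.\<close>

lemma borel_separated_UN:
  assumes "countable I" "countable K" "\<And>i k. i \<in> I \<Longrightarrow> k \<in> K \<Longrightarrow> borel_separated (A i) (B k)"
  shows "borel_separated (\<Union>i\<in>I. A i) (\<Union>k\<in>K. B k)"
proof -
  obtain S where S: "\<And>i k. i \<in> I \<Longrightarrow> k \<in> K \<Longrightarrow> S i k \<in> sets borel \<and> A i \<subseteq> S i k \<and> S i k \<inter> B k = {}"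
    using assms(3) unfolding borel_separated_def by metis
  define T where "T = (\<Union>i\<in>I. space borel \<inter> (\<Inter>k\<in>K. S i k))"
  have "space borel \<inter> (\<Inter>k\<in>K. S i k) \<in> sets borel" if "i \<in> I" for i
  proof (cases "K = {}")
    case False
    then show ?thesis
      using S[OF that] assms(2) by (intro sets.Int sets.top sets.countable_INT') auto
  qed simp
  then have "T \<in> sets borel"
    unfolding T_def using assms(1) by (intro sets.countable_UN') auto
  moreover have "(\<Union>i\<in>I. A i) \<subseteq> T" "T \<inter> (\<Union>k\<in>K. B k) = {}"
    unfolding T_def using S by fastforce+
  ultimately show ?thesis
    unfolding borel_separated_def by blast
qed

lemma closed_countable_small_cover:
  fixes F :: "'a::{metric_space, second_countable_topology} set"
  assumes "closed F" "e > 0"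
  obtains \<C> where "countable \<C>" "\<Union>\<C> = F" "\<And>T. T \<in> \<C> \<Longrightarrow> closed T"
    "\<And>T x y. T \<in> \<C> \<Longrightarrow> x \<in> T \<Longrightarrow> y \<in> T \<Longrightarrow> dist x y \<le> e"
proof -
  obtain D :: "'a set" where D: "countable D" "\<And>U. open U \<Longrightarrow> U \<noteq> {} \<Longrightarrow> \<exists>d\<in>D. d \<in> U"
    using countable_dense_exists by blast
  show thesis
  proof (rule that[of "(\<lambda>d. F \<inter> cball d (e/2)) ` D"])
    show "\<Union> ((\<lambda>d. F \<inter> cball d (e/2)) ` D) = F"
    proof
      show "F \<subseteq> \<Union> ((\<lambda>d. F \<inter> cball d (e/2)) ` D)"
      proof
        fix x assume "x \<in> F"
        obtain d where "d \<in> D" "d \<in> ball x (e/2)"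
          using D(2)[of "ball x (e/2)"] \<open>e > 0\<close> by fastforce
        then show "x \<in> \<Union> ((\<lambda>d. F \<inter> cball d (e/2)) ` D)"
          using \<open>x \<in> F\<close> by (auto simp: dist_commute less_imp_le intro!: bexI[of _ d])
      qed
    qed auto
    fix T x y assume "T \<in> (\<lambda>d. F \<inter> cball d (e/2)) ` D" "x \<in> T" "y \<in> T"
    then obtain d where "dist d x \<le> e/2" "dist d y \<le> e/2" by auto
    then show "dist x y \<le> e" using dist_triangle3[of x y d] by simp
  qed (use D assms in auto)
qed

text \<open>Both sets are cut into countably many closed pieces of diameter at most
  \<open>e\<close>. If the images of all pairs of pieces were separated, so would be the images of
  \<open>F\<close> and \<open>G\<close>; hence some pair of small pieces inherits the
  failure.\<close>

lemma not_borel_separated_refine: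
  fixes F G :: "'a::{metric_space, second_countable_topology} set"
  assumes "closed F" "closed G" "\<not> borel_separated (f ` F) (f ` G)" "e > 0"
  shows "\<exists>F' G'. closed F' \<and> closed G' \<and> F' \<subseteq> F \<and> G' \<subseteq> G \<and> \<not> borel_separated (f ` F') (f ` G') \<and>
    (\<forall>x\<in>F'. \<forall>y\<in>F'. dist x y \<le> e) \<and> (\<forall>x\<in>G'. \<forall>y\<in>G'. dist x y \<le> e)"
proof -
  obtain \<C> where C: "countable \<C>" "\<Union>\<C> = F" "\<And>T. T \<in> \<C> \<Longrightarrow> closed T"
    "\<And>T x y. T \<in> \<C> \<Longrightarrow> x \<in> T \<Longrightarrow> y \<in> T \<Longrightarrow> dist x y \<le> e"
    using closed_countable_small_cover[OF assms(1,4)] by blast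
  obtain \<D> where D: "countable \<D>" "\<Union>\<D> = G" "\<And>T. T \<in> \<D> \<Longrightarrow> closed T"
    "\<And>T x y. T \<in> \<D> \<Longrightarrow> x \<in> T \<Longrightarrow> y \<in> T \<Longrightarrow> dist x y \<le> e"
    using closed_countable_small_cover[OF assms(2,4)] by blast
  have "f ` F = (\<Union>T\<in>\<C>. f ` T)" "f ` G = (\<Union>T\<in>\<D>. f ` T)"
    using C(2) D(2) by auto
  then obtain S T where "S \<in> \<C>" "T \<in> \<D>" "\<not> borel_separated (f ` S) (f ` T)"
    using borel_separated_UN[OF C(1) D(1), of "image f" "image f"] assms(3) by auto
  then show ?thesis
    using C D by (intro exI[of _ S] exI[of _ T]) auto
qed

text \<open>Cantor's intersection theorem. The diameter bound starts at \<open>Suc n\<close> because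
  a refinement starts from arbitrary closed sets, of which no smallness is known.\<close>

lemma closed_nested_small_limit:
  fixes F :: "nat \<Rightarrow> 'a::complete_space set"
  assumes "\<And>n. closed (F n)" "\<And>n. F n \<noteq> {}" "\<And>n. F (Suc n) \<subseteq> F n"
    and "\<And>n x y. x \<in> F (Suc n) \<Longrightarrow> y \<in> F (Suc n) \<Longrightarrow> dist x y \<le> inverse (Suc n)"
  obtains x where "\<And>n. x \<in> F n"
proof -
  have dec: "m \<le> n \<Longrightarrow> F n \<subseteq> F m" for m n
    using lift_Suc_antimono_le[of F] assms(3) by blast
  have "\<exists>a. \<forall>n. a \<in> F n"
  proof (rule decreasing_closed_nest)
    fix e :: real assume "e > 0"
    then obtain n where "inverse (Suc n) < e" using reals_Archimedean by auto
    then show "\<exists>n. \<forall>x\<in>F n. \<forall>y\<in>F n. dist x y < e"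
      using assms(4) by (intro exI[of _ "Suc n"]) (meson le_less_trans)
  qed (use assms dec in auto)
  then show thesis using that by blast
qed

text \<open>Lusin's separation argument. A failure is refined forever, and the shrinking pairs close
  in on points \<open>x\<close> in \<open>F0\<close> and \<open>y\<close> in \<open>G0\<close>. By
  injectivity \<open>f x\<close> and \<open>f y\<close> differ, so they have disjoint open
  neighbourhoods \<open>U\<close> and \<open>V\<close>. By continuity the late pairs are mapped into
  \<open>U\<close> and \<open>V\<close>, and then \<open>U\<close> itself separates them.\<close>

lemma borel_separated_image_closed:
  fixes f :: "'a::{complete_space, second_countable_topology} \<Rightarrow> 'b::t2_space"
  assumes "closed F0" "closed G0" "F0 \<inter> G0 = {}" "continuous_on UNIV f" "inj f"
  shows "borel_separated (f ` F0) (f ` G0)"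
proof (rule ccontr)
  assume ns: "\<not> borel_separated (f ` F0) (f ` G0)"
  define P where "P = (\<lambda>n (F, G). closed F \<and> closed G \<and> F \<subseteq> F0 \<and> G \<subseteq> G0 \<and> \<not> borel_separated (f ` F) (f ` G) \<and>
     (n > 0 \<longrightarrow> (\<forall>x\<in>F. \<forall>y\<in>F. dist x y \<le> inverse (real n)) \<and> (\<forall>x\<in>G. \<forall>y\<in>G. dist x y \<le> inverse (real n))))"
  define Q where "Q = (\<lambda>(n::nat) (F::'a set, G::'a set) (F', G'). F' \<subseteq> F \<and> G' \<subseteq> G)"
  have "\<exists>S. \<forall>n. P n (S n) \<and> Q n (S n) (S (Suc n))"
  proof (rule dependent_nat_choice)
    show "\<exists>x. P 0 x" using assms ns by (auto simp: P_def)
  next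
    fix FG n assume "P n FG"
    then obtain F' G' where "closed F'" "closed G'" "F' \<subseteq> fst FG" "G' \<subseteq> snd FG"
      "\<not> borel_separated (f ` F') (f ` G')"
      "\<forall>x\<in>F'. \<forall>y\<in>F'. dist x y \<le> inverse (Suc n)" "\<forall>x\<in>G'. \<forall>y\<in>G'. dist x y \<le> inverse (Suc n)"
      using not_borel_separated_refine[of "fst FG" "snd FG" f "inverse (real (Suc n))"]
      by (auto simp: P_def case_prod_unfold)
    then show "\<exists>FG'. P (Suc n) FG' \<and> Q n FG FG'"
      using \<open>P n FG\<close> by (intro exI[of _ "(F', G')"]) (auto simp: P_def Q_def case_prod_unfold)
  qed
  then obtain S where S: "\<And>n. P n (S n)" "\<And>n. Q n (S n) (S (Suc n))" by blast
  \<comment> \<open>An empty set is always separated, by \<open>{}\<close> on the left or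
    \<open>UNIV\<close> on the right, so inseparable sets are non-empty.\<close>
  have ne: "fst (S n) \<noteq> {}" "snd (S n) \<noteq> {}" for n
    using S(1)[of n] by (auto simp: P_def borel_separated_def case_prod_unfold)
  have small: "dist x y \<le> inverse (Suc n)"
    if "x \<in> fst (S (Suc n)) \<and> y \<in> fst (S (Suc n)) \<or> x \<in> snd (S (Suc n)) \<and> y \<in> snd (S (Suc n))" for n x y
    using S(1)[of "Suc n"] that by (auto simp: P_def case_prod_unfold)
  obtain x where x: "\<And>n. x \<in> fst (S n)"
    using S ne small by (rule_tac closed_nested_small_limit[of "\<lambda>n. fst (S n)"]) (auto simp: P_def Q_def case_prod_unfold)
  obtain y where y: "\<And>n. y \<in> snd (S n)"
    using S ne small by (rule_tac closed_nested_small_limit[of "\<lambda>n. snd (S n)"]) (auto simp: P_def Q_def case_prod_unfold)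
  have "x \<noteq> y" using x[of 0] y[of 0] S(1)[of 0] assms(3) by (auto simp: P_def case_prod_unfold)
  then have "f x \<noteq> f y" using assms(5) by (simp add: inj_eq)
  then obtain U V where UV: "open U" "open V" "f x \<in> U" "f y \<in> V" "U \<inter> V = {}"
    using hausdorff[of "f x" "f y"] by auto
  have nbhd: "\<exists>e>0. ball z e \<subseteq> f -` W" if "open W" "f z \<in> W" for z W
    using open_vimage[OF that(1) assms(4)] that(2) open_contains_ball_eq by blast
  obtain e1 e2 where e: "e1 > 0" "e2 > 0" "ball x e1 \<subseteq> f -` U" "ball y e2 \<subseteq> f -` V"
    using nbhd[OF UV(1,3)] nbhd[OF UV(2,4)] by blast
  obtain n where n: "inverse (Suc n) < min e1 e2"
    using reals_Archimedean[of "min e1 e2"] e by auto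
  have "fst (S (Suc n)) \<subseteq> ball x e1" "snd (S (Suc n)) \<subseteq> ball y e2"
    using small[of x n] small[of y n] x[of "Suc n"] y[of "Suc n"] n by fastforce+
  then have "borel_separated (f ` fst (S (Suc n))) (f ` snd (S (Suc n)))"
    unfolding borel_separated_def using e UV by (intro bexI[of _ U]) auto
  then show False using S(1)[of "Suc n"] by (simp add: P_def case_prod_unfold)
qed

text \<open>The Borel range is assumed, so that the separation of images of disjoint closed sets suffices.\<close>

lemma borel_image_of_borel:
  fixes f :: "'a::{complete_space, second_countable_topology} \<Rightarrow> 'b::t2_space"
  assumes "continuous_on UNIV f" "inj f" "range f \<in> sets borel" "A \<in> sets borel"
  shows "f ` A \<in> sets borel"
proof -
  have "A \<in> sigma_sets UNIV (Collect closed)"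
    using assms(4) by (simp add: borel_eq_closed)
  then show ?thesis
  proof induction
    case (Basic F)
    then have "closed F" by simp
    then have "open (- F)" by auto
    then have "fsigma_in euclidean (- F)"
      by (intro open_imp_fsigma_in metrizable_space_euclidean) simp
    then obtain G :: "nat \<Rightarrow> 'a set" where G: "\<And>n. closed (G n)" "(\<Union>n. G n) = - F"
      unfolding fsigma_in_ascending by auto
    have "\<exists>S \<in> sets borel. f ` F \<subseteq> S \<and> S \<inter> f ` G n = {}" for n
      using borel_separated_image_closed[OF \<open>closed F\<close> G(1) _ assms(1,2), of n] G(2)
      by (auto simp: borel_separated_def)
    then obtain S where S: "\<And>n. S n \<in> sets borel" "\<And>n. f ` F \<subseteq> S n" "\<And>n. S n \<inter> f ` G n = {}"
      by metis
    \<comment> \<open>The sets \<open>G n\<close> exhaust the complement of \<open>F\<close>, so the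
      separators jointly remove from the range every image of a point outside
      \<open>F\<close>.\<close>
    have "f ` F = range f \<inter> (\<Inter>n. S n)"
    proof (intro equalityI subsetI)
      fix y assume y: "y \<in> range f \<inter> (\<Inter>n. S n)"
      then obtain x where x: "y = f x" by auto
      have "x \<notin> G n" for n using S(3)[of n] y x by auto
      then have "x \<in> F" using G(2) by auto
      then show "y \<in> f ` F" using x by simp
    qed (use S(2) in auto)
    then show ?case using S(1) assms(3) by auto
  next
    case (Compl A)
    have "f ` (UNIV - A) = range f - f ` A"
      using assms(2) by (rule image_set_diff)
    then show ?case using Compl assms(3) by auto
  qed (auto simp: image_UN)
qed

locale borel_embedding =
  fixes P :: "'b::t2_space measure" and f :: "'a::{complete_space, second_countable_topology} \<Rightarrow> 'b"
  assumes prob_P: "prob_space P" and sets_P: "sets P = sets borel"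
    and continuous_f: "continuous_on UNIV f" and inj_f: "inj f" and full: "emeasure P (range f) = 1"
begin

abbreviation "M \<equiv> measure_on_subspace f P"

text \<open>The value 1 already carries the measurability, since \<open>emeasure\<close> is 0 off
  the sigma-algebra.\<close>

lemma range_borel: "range f \<in> sets borel"
  using full emeasure_notin_sets[of "range f" P] sets_P by (metis zero_neq_one)

lemma image_borel: "A \<in> sets borel \<Longrightarrow> f ` A \<in> sets borel"
  by (rule borel_image_of_borel[OF continuous_f inj_f range_borel])

lemma sets_M [simp, measurable_cong]: "sets M = sets borel"
  using sets.sigma_sets_eq[of "borel :: 'a measure"]
  by (simp add: measure_on_subspace_def sets_measure_of_conv)

text \<open>Here Borel images pay off: injectivity keeps disjoint sets disjoint, so the set function
  is countably additive and \<open>measure_of\<close> does not collapse to zero.\<close>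

lemma emeasure_M: "A \<in> sets borel \<Longrightarrow> emeasure M A = emeasure P (f ` A)"
proof (rule emeasure_measure_of[of M UNIV "sets borel" "\<lambda>A. emeasure P (f ` A)"])
  show "countably_additive (sets M) (\<lambda>A. emeasure P (f ` A))"
  proof (rule countably_additiveI)
    fix A :: "nat \<Rightarrow> 'a set" assume A: "range A \<subseteq> sets M" "disjoint_family A"
    have "f ` A m \<inter> f ` A n = f ` (A m \<inter> A n)" for m n
      using inj_f by (rule image_Int[symmetric])
    then have "disjoint_family (\<lambda>i. f ` A i)"
      using A(2) by (simp add: disjoint_family_on_def)
    then show "(\<Sum>i. emeasure P (f ` A i)) = emeasure P (f ` (\<Union>i. A i))"
      unfolding image_UN using A(1)
      by (intro suminf_emeasure) (auto simp: sets_P intro!: image_borel)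
  qed
qed (auto simp: measure_on_subspace_def positive_def)

lemma prob_M: "prob_space M"
  using full emeasure_M[of UNIV] sets_eq_imp_space_eq[OF sets_M]
  by (intro prob_spaceI) simp

text \<open>Taking the image of the preimage cuts \<open>B\<close> down to the range of
  \<open>f\<close>; what is lost lies in the null set outside the range.\<close>

lemma emeasure_vimage: "B \<in> sets borel \<Longrightarrow> emeasure M (f -` B) = emeasure P B"
proof -
  assume B: "B \<in> sets borel"
  have f: "f \<in> borel_measurable borel"
    using continuous_f by (rule borel_measurable_continuous_onI)
  interpret P: prob_space P by (rule prob_P)
  have "P.prob (range f) = 1" using full by (simp add: P.emeasure_eq_measure)
  then have "AE x in P. x \<in> range f"
    using P.prob_eq_1[of "range f"] range_borel sets_P by simp
  then have "emeasure P (B \<inter> range f) = emeasure P B"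
    using B range_borel by (intro emeasure_eq_AE) (auto simp: sets_P)
  then show "emeasure M (f -` B) = emeasure P B"
    using emeasure_M[of "f -` B"] measurable_sets[OF f B] by (simp add: image_vimage_eq)
qed

lemma distr_M: "distr M borel f = P"
proof (rule measure_eqI)
  fix B assume "B \<in> sets (distr M borel f)"
  moreover have "f \<in> measurable M borel"
    using borel_measurable_continuous_onI[OF continuous_f] by (simp cong: measurable_cong_sets)
  ultimately show "emeasure (distr M borel f) B = emeasure P B"
    using emeasure_vimage[of B] sets_eq_imp_space_eq[OF sets_M] by (simp add: emeasure_distr)
qed (simp add: sets_P)

end

section \<open>Characteristic functions determine measures on a Hilbert space\<close>

text \<open>Normalised by its integral \<open>m\<close>, the weight \<open>w\<close> is a
  probability density, and the law of \<open>X\<close> under it is determined by its characteristic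
  function. The free phase \<open>c\<close> lets one real family of integrals encode both parts of
  it: \<open>c = 0\<close> gives the real part and \<open>c = - pi / 2\<close> turns the cosine into
  a sine.\<close>

lemma integral_mult_indicator_vimage_eq:
  fixes M N :: "'a measure" and w X :: "'a \<Rightarrow> real"
  assumes "prob_space M" "prob_space N" and sets: "sets N = sets M"
    and meas [measurable]: "w \<in> borel_measurable M" "X \<in> borel_measurable M"
    and w: "\<And>x. 0 \<le> w x" "\<And>x. w x \<le> K"
    and eq: "\<And>t c. (\<integral>x. w x * cos (t * X x + c) \<partial>M) = (\<integral>x. w x * cos (t * X x + c) \<partial>N)"
    and B [measurable]: "B \<in> sets borel"
  shows "(\<integral>x. w x * indicator B (X x) \<partial>M) = (\<integral>x. w x * indicator B (X x) \<partial>N)"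
proof -
  define m where "m = (\<integral>x. w x \<partial>M)"
  have m_eq: "m = (\<integral>x. w x \<partial>N)"
    using eq[of 0 0] by (simp add: m_def)
  define law where "law = (\<lambda>P. distr (density P (\<lambda>x. ennreal (w x / m))) borel X)"
  have law: "real_distribution (law P) \<and>
      char (law P) t = complex_of_real ((\<integral>x. w x * cos (t * X x) \<partial>P) / m) +
        \<i> * complex_of_real ((\<integral>x. w x * cos (t * X x + (- pi / 2)) \<partial>P) / m) \<and>
      measure (law P) B = (\<integral>x. w x * indicator B (X x) \<partial>P) / m"
    if "m > 0" and P: "P = M \<or> P = N" for P t
  proof -
    have sets_P [measurable_cong]: "sets P = sets M" using P sets by auto
    interpret P: prob_space P using P assms by auto
    have bounded: "integrable P (\<lambda>x. w x * g x)" if [measurable]: "g \<in> borel_measurable M" 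
      and "\<And>x. \<bar>g x\<bar> \<le> 1" for g :: "'a \<Rightarrow> real"
    proof (rule P.integrable_const_bound[of _ K])
      show "AE x in P. norm (w x * g x) \<le> K"
      proof (rule AE_I2)
        fix x show "norm (w x * g x) \<le> K"
          using mult_mono[of "w x" K "\<bar>g x\<bar>" 1] w[of x] that(2)[of x] by (simp add: abs_mult)
      qed
    qed simp
    have int_w: "integrable P w" using bounded[of "\<lambda>_. 1"] by simp
    have "(\<integral>\<^sup>+x. ennreal (w x / m) \<partial>P) = ennreal (\<integral>x. w x / m \<partial>P)"
      using w int_w \<open>m > 0\<close> by (intro nn_integral_eq_integral) auto
    also have "(\<integral>x. w x / m \<partial>P) = 1" using P m_def m_eq \<open>m > 0\<close> by auto
    finally have "prob_space (density P (\<lambda>x. ennreal (w x / m)))"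
      by (intro prob_spaceI) (simp add: emeasure_density)
    then have prob: "prob_space (law P)" unfolding law_def by (rule prob_space.prob_space_distr) simp
    have c: "complex_integrable P (\<lambda>x. complex_of_real (w x * cos (t * X x) / m))"
      "complex_integrable P (\<lambda>x. complex_of_real (w x * cos (t * X x + (- pi / 2)) / m))"
      by (intro integrable_of_real integrable_divide_zero bounded; simp)+
    have "char (law P) t = (CLINT x|P. (w x / m) *\<^sub>R iexp (t * X x))"
      unfolding law_def char_def using w \<open>m > 0\<close>
      by (subst integral_distr, simp, simp) (subst integral_density, auto)
    also have "\<dots> = (CLINT x|P. complex_of_real (w x * cos (t * X x) / m) +
        \<i> * complex_of_real (w x * cos (t * X x + (- pi / 2)) / m))"
      by (intro Bochner_Integration.integral_cong refl complex_eqI)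
         (simp_all add: Re_exp Im_exp cos_diff)
    also have "\<dots> = (CLINT x|P. complex_of_real (w x * cos (t * X x) / m)) +
        \<i> * (CLINT x|P. complex_of_real (w x * cos (t * X x + (- pi / 2)) / m))"
      using c by (subst Bochner_Integration.integral_add) (auto simp del: of_real_divide of_real_mult)
    finally have char: "char (law P) t = complex_of_real ((\<integral>x. w x * cos (t * X x) \<partial>P) / m) +
        \<i> * complex_of_real ((\<integral>x. w x * cos (t * X x + (- pi / 2)) \<partial>P) / m)"
      by (simp only: integral_complex_of_real integral_divide_zero)
    have "measure (law P) B = (\<integral>y. indicator B y \<partial>law P)" by (simp add: law_def)
    also have "\<dots> = (\<integral>x. (w x / m) * indicator B (X x) \<partial>P)"
      unfolding law_def using w \<open>m > 0\<close> 
      by (subst integral_distr, simp, simp) (subst integral_density, auto)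
    also have "\<dots> = (\<integral>x. w x * indicator B (X x) / m \<partial>P)" by simp
    finally have "measure (law P) B = (\<integral>x. w x * indicator B (X x) \<partial>P) / m"
      by simp
    then show ?thesis
      using prob char by (simp add: real_distribution_def real_distribution_axioms_def law_def)
  qed
  show ?thesis
  proof (cases "m > 0")
    case True
    have "char (law M) = char (law N)"
    proof
      fix t
      show "char (law M) t = char (law N) t"
        using law[OF True, of M t] law[OF True, of N t] eq[of t 0] eq[of t "- pi / 2"] by simp
    qed
    then have "law M = law N"
      using law[OF True] by (intro Levy_uniqueness) auto
    then show ?thesis using law[OF True, of M] law[OF True, of N] True by simp
  next
    \<comment> \<open>Now \<open>m = 0\<close>, since \<open>w\<close> is non-negative. There is no
      density to normalise, but both sides are squeezed between 0 and \<open>m\<close>.\<close>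
    case False
    have "(\<integral>x. w x * indicator B (X x) \<partial>P) = 0" if P: "P = M \<or> P = N" for P
    proof -
      have sets_P [measurable_cong]: "sets P = sets M" using P sets by auto
      interpret P: prob_space P using P assms by auto
      have int_w: "integrable P w"
        using w by (intro P.integrable_const_bound[of _ K]) auto
      have "(\<integral>x. w x * indicator B (X x) \<partial>P) \<le> (\<integral>x. w x \<partial>P)"
        using w int_w by (intro integral_mono' ) (auto simp: indicator_def)
      then have "(\<integral>x. w x * indicator B (X x) \<partial>P) \<le> 0" using P m_def m_eq False by auto
      moreover have "(\<integral>x. w x * indicator B (X x) \<partial>P) \<ge> 0" using w by (intro integral_nonneg_AE) auto
      ultimately show ?thesis by simp
    qed
    then show ?thesis by simp
  qed
qed

text \<open>By Cauchy-Schwarz a closed ball is the intersection of the half-spaces that contain it,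
  and a countable dense set of directions suffices. Open sets are countable unions of balls with
  centres in the dense set and rational radii.\<close>

lemma borel_sigma_halfspaces:
  "sets (borel :: 'h::{real_inner, second_countable_topology} measure) =
    sigma_sets UNIV {{x. x \<bullet> h \<le> a} | h a. True}" (is "_ = sigma_sets UNIV ?E")
proof
  obtain D :: "'h set" where D: "countable D" "\<And>U. open U \<Longrightarrow> U \<noteq> {} \<Longrightarrow> \<exists>d\<in>D. d \<in> U"
    using countable_dense_exists by blast
  then have "D \<noteq> {}" using D(2)[of UNIV] by auto
  interpret S: sigma_algebra UNIV "sigma_sets UNIV ?E" by (rule sigma_algebra_sigma_sets) simp
  have cball: "cball c r \<in> sigma_sets UNIV ?E" for c :: 'h and r :: real
  proof -
    have "cball c r = (\<Inter>d\<in>D. {x. x \<bullet> d \<le> c \<bullet> d + r * norm d})" if "r \<ge> 0"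
    proof (intro equalityI subsetI)
      fix x assume x: "x \<in> (\<Inter>d\<in>D. {x. x \<bullet> d \<le> c \<bullet> d + r * norm d})"
      \<comment> \<open>Closedness extends the inequality from \<open>D\<close> to all directions;
        at \<open>d = x - c\<close> it reads
        \<open>(norm (x - c))\<^sup>2 \<le> r * norm (x - c)\<close>.\<close>
      have "closed {d. x \<bullet> d \<le> c \<bullet> d + r * norm d}"
        by (intro closed_Collect_le continuous_intros)
      then have "x - c \<in> {d. x \<bullet> d \<le> c \<bullet> d + r * norm d}"
        using D(2)[of "- {d. x \<bullet> d \<le> c \<bullet> d + r * norm d}"] x by (force simp: closed_def)
      then have "norm (x - c) * norm (x - c) \<le> r * norm (x - c)"
        using inner_diff_left[of x c "x - c"] by (simp add: dot_square_norm power2_eq_square)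
      then have "norm (x - c) \<le> r" using that by (cases "norm (x - c) = 0") auto
      then show "x \<in> cball c r" by (simp add: dist_norm norm_minus_commute)
    next
      fix x assume "x \<in> cball c r"
      then have "norm (x - c) \<le> r" by (simp add: dist_norm norm_minus_commute)
      have "x \<bullet> d \<le> c \<bullet> d + r * norm d" for d
      proof -
        have "(x - c) \<bullet> d \<le> norm (x - c) * norm d" by (rule norm_cauchy_schwarz)
        also have "\<dots> \<le> r * norm d" using \<open>norm (x - c) \<le> r\<close> by (simp add: mult_right_mono)
        finally show ?thesis by (simp add: inner_diff_left)
      qed
      then show "x \<in> (\<Inter>d\<in>D. {x. x \<bullet> d \<le> c \<bullet> d + r * norm d})" by auto
    qed
    moreover have "(\<Inter>d\<in>D. {x. x \<bullet> d \<le> c \<bullet> d + r * norm d}) \<in> sigma_sets UNIV ?E"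
      using D(1) \<open>D \<noteq> {}\<close> by (intro S.countable_INT' image_subsetI sigma_sets.Basic) auto
    moreover have "cball c r = {}" if "r < 0" using that by simp
    ultimately show ?thesis by (cases "r \<ge> 0") (auto intro: sigma_sets.Empty)
  qed
  have "open U \<Longrightarrow> U \<in> sigma_sets UNIV ?E" for U :: "'h set"
  proof -
    assume U: "open U"
    have "U = (\<Union>(d, r) \<in> {(d, r). d \<in> D \<and> r \<in> \<rat> \<and> cball d r \<subseteq> U}. cball d r)"
    proof (intro equalityI subsetI)
      fix x assume "x \<in> U"
      then obtain e where e: "e > 0" "cball x e \<subseteq> U" using U open_contains_cball by blast
      obtain r where r: "r \<in> \<rat>" "0 < r" "r < e / 2"
        using Rats_dense_in_real[of 0 "e/2"] e by auto
      obtain d where d: "d \<in> D" "d \<in> ball x r" using D(2)[of "ball x r"] r by auto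
      have "cball d r \<subseteq> cball x e"
      proof
        fix z assume "z \<in> cball d r"
        then show "z \<in> cball x e" using d r dist_triangle[of x z d] by simp
      qed
      then show "x \<in> (\<Union>(d, r) \<in> {(d, r). d \<in> D \<and> r \<in> \<rat> \<and> cball d r \<subseteq> U}. cball d r)"
        using d r e by (auto intro!: exI[of _ d] exI[of _ r] simp: dist_commute)
    qed auto
    moreover have "countable {(d, r). d \<in> D \<and> r \<in> \<rat> \<and> cball d r \<subseteq> U}"
      by (rule countable_subset[of _ "D \<times> \<rat>"]) (auto simp: D countable_rat)
    ultimately show "U \<in> sigma_sets UNIV ?E"
      using cball by (subst \<open>U = _\<close>, intro S.countable_UN') auto
  qed
  then have "Collect open \<subseteq> sigma_sets UNIV ?E" by auto
  then show "sets borel \<subseteq> sigma_sets UNIV ?E"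
    using S.sigma_sets_subset[of "Collect open"] by (simp add: borel_def)
  have "?E \<subseteq> sets (borel :: 'h measure)" by auto
  then show "sigma_sets UNIV ?E \<subseteq> sets (borel :: 'h measure)"
    using sets.sigma_sets_subset[of ?E "borel :: 'h measure"] by simp
qed

text \<open>
  Weights \<open>g\<close> that do not separate \<open>M\<close> from \<open>N\<close> stay so when multiplied by the indicator of a
  half-space: \<open>1 + cos (x \<bullet> h + c)\<close> is non-negative, so Levy's one-dimensional uniqueness theorem
  applies to the law of \<open>x \<bullet> k\<close> under the density \<open>g (1 + cos (x \<bullet> h + c))\<close>.
\<close>

lemma measure_eqI_cos_inner:
  fixes M N :: "'h::{real_inner, second_countable_topology} measure"
  assumes "prob_space M" "prob_space N" "sets M = sets borel" "sets N = sets borel"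
    and eq: "\<And>h c. (\<integral>x. cos (x \<bullet> h + c) \<partial>M) = (\<integral>x. cos (x \<bullet> h + c) \<partial>N)"
  shows "M = N"
proof -
  interpret M: prob_space M by fact
  interpret N: prob_space N by fact
  have sets_M [measurable_cong]: "sets M = sets borel" and sets_N [measurable_cong]: "sets N = sets borel" by fact+
  \<comment> \<open>Half-spaces are not stable under intersection, so they cannot serve as a
    generator themselves. \<open>E\<close> is stable by construction: multiplying by two indicators
    in turn stays inside \<open>G\<close>. For half-spaces to lie in \<open>E\<close>, membership in
    \<open>G\<close> has to demand equality for all cosines and not only for total masses.\<close>
  define G where "G = {g :: 'h \<Rightarrow> real. g \<in> borel_measurable borel \<and> (\<forall>x. 0 \<le> g x \<and> g x \<le> 1) \<and>
    (\<forall>h c. (\<integral>x. g x * cos (x \<bullet> h + c) \<partial>M) = (\<integral>x. g x * cos (x \<bullet> h + c) \<partial>N))}"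
  define E where "E = {A \<in> sets borel. \<forall>g\<in>G. (\<lambda>x. g x * indicator A x) \<in> G}"
  have int: "integrable P (\<lambda>x. g x * f x)"
    if "g \<in> G" and [measurable]: "f \<in> borel_measurable borel" and f: "\<And>x. \<bar>f x\<bar> \<le> 1" and P: "P = M \<or> P = N"
    for P :: "'h measure" and g f
  proof -
    interpret P: prob_space P using P assms(1,2) by auto
    have [measurable_cong]: "sets P = sets borel" using P sets_M sets_N by auto
    have [measurable]: "g \<in> borel_measurable borel" and g: "\<And>x. \<bar>g x\<bar> \<le> 1"
      using \<open>g \<in> G\<close> by (auto simp: G_def)
    show ?thesis
      by (rule P.integrable_const_bound[of _ 1]) (auto simp: abs_mult intro!: mult_le_one g f AE_I2)
  qed
  have halfspace: "{x. x \<bullet> k \<le> a} \<in> E" for k a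
    unfolding E_def
  proof (intro CollectI conjI ballI)
    show "{x. x \<bullet> k \<le> a} \<in> sets (borel :: 'h measure)" by measurable
    fix g assume g: "g \<in> G"
    have [measurable]: "g \<in> borel_measurable borel" and g01: "\<And>x. 0 \<le> g x" "\<And>x. g x \<le> 1"
      and geq: "\<And>h c. (\<integral>x. g x * cos (x \<bullet> h + c) \<partial>M) = (\<integral>x. g x * cos (x \<bullet> h + c) \<partial>N)"
      using g by (auto simp: G_def)
    define I where "I = (\<lambda>x :: 'h. indicator {..a} (x \<bullet> k) :: real)"
    have [measurable]: "I \<in> borel_measurable borel" unfolding I_def by measurable
    have I01: "\<bar>I x\<bar> \<le> 1" for x by (simp add: I_def indicator_def)
    have weighted: "(\<integral>x. g x * (1 + cos (x \<bullet> h + c)) * I x \<partial>M) = (\<integral>x. g x * (1 + cos (x \<bullet> h + c)) * I x \<partial>N)" for h c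
      unfolding I_def
    proof (rule integral_mult_indicator_vimage_eq[of M N _ _ 2])
      fix x
      show "0 \<le> g x * (1 + cos (x \<bullet> h + c))"
        using g01(1)[of x] cos_ge_minus_one[of "x \<bullet> h + c"] by (intro mult_nonneg_nonneg) linarith+
      have "g x * (1 + cos (x \<bullet> h + c)) \<le> 1 * 2"
        using g01[of x] cos_le_one[of "x \<bullet> h + c"] cos_ge_minus_one[of "x \<bullet> h + c"]
        by (intro mult_mono) linarith+
      then show "g x * (1 + cos (x \<bullet> h + c)) \<le> 2" by simp
    next
      fix t d
      \<comment> \<open>The product of two cosines splits into cosines with frequencies
        \<open>h + t *\<^sub>R k\<close> and \<open>h - t *\<^sub>R k\<close>, on each of which
        \<open>M\<close> and \<open>N\<close> agree by \<open>geq\<close>.\<close>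
      have expand: "(\<integral>x. g x * (1 + cos (x \<bullet> h + c)) * cos (t * (x \<bullet> k) + d) \<partial>P) =
          (\<integral>x. g x * cos (x \<bullet> (t *\<^sub>R k) + d) \<partial>P) + ((\<integral>x. g x * cos (x \<bullet> (h + t *\<^sub>R k) + (c + d)) \<partial>P) +
           (\<integral>x. g x * cos (x \<bullet> (h - t *\<^sub>R k) + (c - d)) \<partial>P)) / 2"
        if P: "P = M \<or> P = N" for P
      proof -
        have [measurable_cong]: "sets P = sets borel" using P sets_M sets_N by auto
        have i: "integrable P (\<lambda>x. g x * cos (x \<bullet> l + e))" for l e
          using P by (intro int g) auto
        have "(\<integral>x. g x * (1 + cos (x \<bullet> h + c)) * cos (t * (x \<bullet> k) + d) \<partial>P) =
          (\<integral>x. g x * cos (x \<bullet> (t *\<^sub>R k) + d) + (g x * cos (x \<bullet> (h + t *\<^sub>R k) + (c + d)) +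
             g x * cos (x \<bullet> (h - t *\<^sub>R k) + (c - d))) / 2 \<partial>P)"
        proof (intro Bochner_Integration.integral_cong refl)
          fix x
          have "cos (x \<bullet> h + c) * cos (t * (x \<bullet> k) + d) =
            (cos (x \<bullet> (h - t *\<^sub>R k) + (c - d)) + cos (x \<bullet> (h + t *\<^sub>R k) + (c + d))) / 2"
            by (simp add: cos_times_cos inner_add_right inner_diff_right algebra_simps)
          then show "g x * (1 + cos (x \<bullet> h + c)) * cos (t * (x \<bullet> k) + d) =
            g x * cos (x \<bullet> (t *\<^sub>R k) + d) + (g x * cos (x \<bullet> (h + t *\<^sub>R k) + (c + d)) +
             g x * cos (x \<bullet> (h - t *\<^sub>R k) + (c - d))) / 2"
            by (simp add: distrib_left distrib_right mult.assoc add_divide_distrib)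
        qed
        also have "\<dots> = (\<integral>x. g x * cos (x \<bullet> (t *\<^sub>R k) + d) \<partial>P) + ((\<integral>x. g x * cos (x \<bullet> (h + t *\<^sub>R k) + (c + d)) \<partial>P) +
           (\<integral>x. g x * cos (x \<bullet> (h - t *\<^sub>R k) + (c - d)) \<partial>P)) / 2"
          using i[of "t *\<^sub>R k" d] i[of "h + t *\<^sub>R k" "c + d"] i[of "h - t *\<^sub>R k" "c - d"]
          by (simp only: Bochner_Integration.integral_add integral_divide_zero Bochner_Integration.integrable_add integrable_divide_zero)
        finally show ?thesis .
      qed
      show "(\<integral>x. g x * (1 + cos (x \<bullet> h + c)) * cos (t * (x \<bullet> k) + d) \<partial>M) = (\<integral>x. g x * (1 + cos (x \<bullet> h + c)) * cos (t * (x \<bullet> k) + d) \<partial>N)"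
        by (simp only: expand[OF disjI1[OF refl]] expand[OF disjI2[OF refl]] geq)
    qed (use assms in auto)
    have split: "(\<integral>x. g x * (1 + cos (x \<bullet> h + c)) * I x \<partial>P) = (\<integral>x. g x * I x \<partial>P) + (\<integral>x. g x * I x * cos (x \<bullet> h + c) \<partial>P)"
      if P: "P = M \<or> P = N" for P h c
    proof -
      have "integrable P (\<lambda>x. g x * (I x * cos (x \<bullet> h + c)))"
        using P I01 by (intro int g) (auto simp: abs_mult intro!: mult_le_one)
      then have "integrable P (\<lambda>x. g x * I x * cos (x \<bullet> h + c))" by (simp add: mult.assoc)
      moreover have "integrable P (\<lambda>x. g x * I x)" using P I01 by (intro int g) auto
      ultimately show ?thesis
        by (subst Bochner_Integration.integral_add[symmetric])
           (auto simp: algebra_simps intro!: Bochner_Integration.integral_cong)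
    qed
    \<comment> \<open>The choice \<open>h = 0\<close>, \<open>c = pi / 2\<close> makes the cosine
      vanish and leaves the bare weight \<open>g\<close>; subtracting this case isolates the cosine
      term.\<close>
    have base: "(\<integral>x. g x * I x \<partial>M) = (\<integral>x. g x * I x \<partial>N)"
      using weighted[of 0 "pi / 2"] by simp
    have "(\<integral>x. g x * I x * cos (x \<bullet> h + c) \<partial>M) = (\<integral>x. g x * I x * cos (x \<bullet> h + c) \<partial>N)" for h c
      using weighted[of h c] split[of M h c] split[of N h c] base by simp
    then have "(\<lambda>x. g x * I x) \<in> G"
      using g01 I01 by (auto simp: G_def I_def indicator_def)
    then show "(\<lambda>x. g x * indicator {x. x \<bullet> k \<le> a} x) \<in> G"
      by (simp add: I_def indicator_def)
  qed
  have E_sets: "E \<subseteq> sets borel" by (auto simp: E_def)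
  have sigma_E: "sigma_sets UNIV E = sets borel"
  proof
    show "sigma_sets UNIV E \<subseteq> sets borel"
      using sets.sigma_sets_subset[OF E_sets] by simp
    show "sets borel \<subseteq> sigma_sets UNIV E"
      unfolding borel_sigma_halfspaces by (rule sigma_sets_mono') (use halfspace in auto)
  qed
  have one: "(\<lambda>_. 1) \<in> G" using eq by (auto simp: G_def)
  show ?thesis
  proof (rule measure_eqI_generator_eq[of E UNIV])
    show "Int_stable E"
    proof (rule Int_stableI)
      fix A B assume AB: "A \<in> E" "B \<in> E"
      have "(\<lambda>x. g x * indicator (A \<inter> B) x) \<in> G" if "g \<in> G" for g
      proof -
        have "(\<lambda>x. g x * indicator A x * indicator B x) \<in> G" using AB that by (auto simp: E_def)
        then show ?thesis by (simp add: indicator_inter_arith mult.assoc)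
      qed
      then show "A \<inter> B \<in> E" using AB by (auto simp: E_def)
    qed
    fix A assume A: "A \<in> E"
    then have "(\<lambda>x. 1 * indicator A x) \<in> G" using one by (auto simp: E_def)
    then have "(\<integral>x. indicator A x * cos (x \<bullet> 0 + 0) \<partial>M) = (\<integral>x. indicator A x * cos (x \<bullet> 0 + 0) \<partial>N)"
      unfolding G_def by (simp only: mem_Collect_eq mult_1)
    then show "emeasure M A = emeasure N A"
      using A sets_eq_imp_space_eq[OF sets_M] sets_eq_imp_space_eq[OF sets_N]
      by (simp add: M.emeasure_eq_measure N.emeasure_eq_measure)
  next
    show "range (\<lambda>i. UNIV) \<subseteq> E" by (auto simp: E_def)
  qed (use E_sets sigma_E assms in auto)
qed

section \<open>Rotation invariance and Fernique's theorem\<close>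

lemma centred_gaussianD:
  assumes "centred_gaussian C \<mu>"
  shows "prob_space \<mu>" "sets \<mu> = sets borel"
  using assms by (auto simp: centred_gaussian_def)

lemma char_normal_law:
  assumes "v \<ge> 0"
  shows "char (normal_law 0 v) t = complex_of_real (exp (- v * t\<^sup>2 / 2))"
proof (cases "v = 0")
  case True
  then show ?thesis by (simp add: normal_law_def char_def integral_return)
next
  case False
  define s where "s = sqrt v"
  have s: "s > 0" "s\<^sup>2 = v" using assms False by (auto simp: s_def)
  have "char (normal_law 0 v) t = (CLINT x|lborel. normal_density 0 s x *\<^sub>R iexp (t * x))"
    using False by (simp add: normal_law_def char_def s_def integral_density)
  also have "\<dots> = s *\<^sub>R (CLINT x|lborel. normal_density 0 s (s * x) *\<^sub>R iexp (t * (s * x)))"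
    using s by (subst lborel_integral_real_affine[where c = s and t = 0]) auto
  also have "\<dots> = (CLINT x|lborel. std_normal_density x *\<^sub>R iexp (t * s * x))"
  proof (subst integral_scaleR_right[symmetric], intro Bochner_Integration.integral_cong refl)
    fix x
    have "s * normal_density 0 s (s * x) = std_normal_density x"
      using s(1) by (simp add: normal_density_def power_mult_distrib real_sqrt_mult)
    then show "s *\<^sub>R (normal_density 0 s (s * x) *\<^sub>R iexp (t * (s * x))) = std_normal_density x *\<^sub>R iexp (t * s * x)"
      by (simp add: mult.assoc flip: of_real_mult)
  qed
  also have "\<dots> = char std_normal_distribution (t * s)"
    by (simp add: char_def integral_density)
  finally show ?thesis
    using s by (simp add: char_std_normal_distribution power_mult_distrib mult.commute)
qed

text \<open>The definition prescribes only one-dimensional marginals; the value at \<open>h\<close>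
  is the characteristic function of the marginal in direction \<open>h\<close>, taken at 1.\<close>

lemma char_centred_gaussian:
  assumes "centred_gaussian C \<mu>"
  shows "(CLINT x|\<mu>. iexp (x \<bullet> h)) = complex_of_real (exp (- (C h \<bullet> h) / 2))"
proof -
  have [measurable_cong]: "sets \<mu> = sets borel" using assms by (simp add: centred_gaussian_def)
  have "(CLINT x|\<mu>. iexp (x \<bullet> h)) = char (distr \<mu> borel (\<lambda>x. x \<bullet> h)) 1"
    by (simp add: char_def integral_distr)
  also have "distr \<mu> borel (\<lambda>x. x \<bullet> h) = normal_law 0 (C h \<bullet> h)"
    using assms by (simp add: centred_gaussian_def)
  also have "char (normal_law 0 (C h \<bullet> h)) 1 = complex_of_real (exp (- (C h \<bullet> h) / 2))"
  proof -
    have "0 \<le> C h \<bullet> h" using assms unfolding centred_gaussian_def by blast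
    then show ?thesis using char_normal_law[of "C h \<bullet> h" 1] by simp
  qed
  finally show ?thesis .
qed

text \<open>With this choice of signs the map is self-adjoint and its own inverse: a rotation by 45
  degrees followed by a reflection. It needs only a vector space, so the same map acts on pairs from
  \<open>X\<close> and from \<open>H\<close>.\<close>

definition rotate45 :: "'a::real_vector \<times> 'a \<Rightarrow> 'a \<times> 'a" where
  "rotate45 z = ((1 / sqrt 2) *\<^sub>R (fst z + snd z), (1 / sqrt 2) *\<^sub>R (fst z - snd z))"

lemma continuous_rotate45: "continuous_on UNIV (rotate45 :: 'a::real_normed_vector \<times> 'a \<Rightarrow> _)"
  unfolding rotate45_def[abs_def] by (intro continuous_intros)

lemma borel_measurable_rotate45 [measurable]:
  "(rotate45 :: 'a::{real_normed_vector, second_countable_topology} \<times> 'a \<Rightarrow> _) \<in> borel \<Otimes>\<^sub>M borel \<rightarrow>\<^sub>M borel \<Otimes>\<^sub>M borel"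
  using borel_measurable_continuous_onI[OF continuous_rotate45] by (simp add: borel_prod)

text \<open>The characteristic function of the product at \<open>(h, k)\<close> depends on
  \<open>C h \<bullet> h + C k \<bullet> k\<close> alone. The rotation is self-adjoint, hence can be
  moved to \<open>(h, k)\<close>, and there the parallelogram identity leaves the form
  unchanged.\<close>

lemma distr_rotate45_gaussian:
  fixes \<mu> :: "'h::{real_inner, complete_space, second_countable_topology} measure"
  assumes "centred_gaussian C \<mu>"
  shows "distr (\<mu> \<Otimes>\<^sub>M \<mu>) (borel \<Otimes>\<^sub>M borel) rotate45 = \<mu> \<Otimes>\<^sub>M \<mu>"
proof -
  have sets [measurable_cong]: "sets \<mu> = sets borel" and "prob_space \<mu>" and "bounded_linear C"
    using assms by (auto simp: centred_gaussian_def)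
  interpret C: bounded_linear C by fact
  interpret prob_space \<mu> by fact
  interpret pair_prob_space \<mu> \<mu> ..
  have sets2: "sets (\<mu> \<Otimes>\<^sub>M \<mu>) = sets (borel :: ('h \<times> 'h) measure)"
    by (rule sets_pair_measure_cong[OF sets sets, unfolded borel_prod])
  have char: "(CLINT z|\<mu> \<Otimes>\<^sub>M \<mu>. iexp (z \<bullet> (h, k))) = complex_of_real (exp (- (C h \<bullet> h + C k \<bullet> k) / 2))" for h k
  proof -
    have "complex_integrable (\<mu> \<Otimes>\<^sub>M \<mu>) (\<lambda>z. iexp (fst z \<bullet> h) * iexp (snd z \<bullet> k))"
      by (rule P.integrable_const_bound[of _ 1]) (auto simp: norm_mult intro!: AE_I2)
    then have "(CLINT x|\<mu>. CLINT y|\<mu>. iexp (x \<bullet> h) * iexp (y \<bullet> k)) =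
        (CLINT z|\<mu> \<Otimes>\<^sub>M \<mu>. iexp (fst z \<bullet> h) * iexp (snd z \<bullet> k))"
      using integral_fst'[of "\<lambda>z. iexp (fst z \<bullet> h) * iexp (snd z \<bullet> k)"] by simp
    moreover have "(CLINT z|\<mu> \<Otimes>\<^sub>M \<mu>. iexp (z \<bullet> (h, k))) = (CLINT z|\<mu> \<Otimes>\<^sub>M \<mu>. iexp (fst z \<bullet> h) * iexp (snd z \<bullet> k))"
      by (simp add: inner_prod_def exp_add[symmetric] distrib_left)
    ultimately have "(CLINT z|\<mu> \<Otimes>\<^sub>M \<mu>. iexp (z \<bullet> (h, k))) = (CLINT x|\<mu>. CLINT y|\<mu>. iexp (x \<bullet> h) * iexp (y \<bullet> k))"
      by simp
    also have "\<dots> = complex_of_real (exp (- (C h \<bullet> h) / 2)) * complex_of_real (exp (- (C k \<bullet> k) / 2))"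
      by (simp add: char_centred_gaussian[OF assms])
    finally show ?thesis by (simp add: exp_add[symmetric] add_divide_distrib flip: of_real_mult)
  qed
  have rot: "rotate45 z \<bullet> w = z \<bullet> rotate45 w" for z w :: "'h \<times> 'h"
    by (simp add: rotate45_def inner_prod_def inner_add_left inner_add_right inner_diff_left inner_diff_right algebra_simps)
  have C_rot: "C (fst (rotate45 w)) \<bullet> fst (rotate45 w) + C (snd (rotate45 w)) \<bullet> snd (rotate45 w) =
    C (fst w) \<bullet> fst w + C (snd w) \<bullet> snd w" for w
    by (simp add: rotate45_def C.scaleR C.add C.diff inner_add_left inner_add_right inner_diff_left inner_diff_right field_simps)
  have char_rot: "(CLINT z|\<mu> \<Otimes>\<^sub>M \<mu>. iexp (rotate45 z \<bullet> w)) = (CLINT z|\<mu> \<Otimes>\<^sub>M \<mu>. iexp (z \<bullet> w))" for w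
    using char[of "fst w" "snd w"] char[of "fst (rotate45 w)" "snd (rotate45 w)"] C_rot[of w] by (simp add: rot)
  \<comment> \<open>A phase-shifted cosine is the real part of \<open>iexp c * iexp (f z)\<close>,
    which links the complex characteristic function to the criterion in terms of cosines.\<close>
  have cos_eq: "(\<integral>z. cos (f z + c) \<partial>(\<mu> \<Otimes>\<^sub>M \<mu>)) = Re (iexp c * (CLINT z|\<mu> \<Otimes>\<^sub>M \<mu>. iexp (f z)))"
    if [measurable]: "f \<in> borel_measurable (borel \<Otimes>\<^sub>M borel)" for f c
  proof -
    have "complex_integrable (\<mu> \<Otimes>\<^sub>M \<mu>) (\<lambda>z. iexp c * iexp (f z))"
      by (rule P.integrable_const_bound[of _ 1]) (auto simp: norm_mult intro!: AE_I2)
    then have "(\<integral>z. Re (iexp c * iexp (f z)) \<partial>(\<mu> \<Otimes>\<^sub>M \<mu>)) = Re (CLINT z|\<mu> \<Otimes>\<^sub>M \<mu>. iexp c * iexp (f z))"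
      by (rule integral_Re)
    moreover have "Re (iexp c * iexp (f z)) = cos (f z + c)" for z
      by (simp add: Re_exp add.commute flip: exp_add distrib_left of_real_add)
    ultimately show ?thesis by simp
  qed
  show ?thesis
  proof (rule measure_eqI_cos_inner)
    show "prob_space (distr (\<mu> \<Otimes>\<^sub>M \<mu>) (borel \<Otimes>\<^sub>M borel) rotate45)" by (rule P.prob_space_distr) simp
    show "prob_space (\<mu> \<Otimes>\<^sub>M \<mu>)" by (rule P.prob_space_axioms)
    fix w :: "'h \<times> 'h" and c :: real
    have m1 [measurable]: "(\<lambda>z. z \<bullet> w) \<in> borel_measurable (borel \<Otimes>\<^sub>M borel)" by (simp add: borel_prod)
    have m2: "(\<lambda>z. rotate45 z \<bullet> w) \<in> borel_measurable (borel \<Otimes>\<^sub>M borel)" by measurable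
    show "(\<integral>z. cos (z \<bullet> w + c) \<partial>distr (\<mu> \<Otimes>\<^sub>M \<mu>) (borel \<Otimes>\<^sub>M borel) rotate45) = (\<integral>z. cos (z \<bullet> w + c) \<partial>(\<mu> \<Otimes>\<^sub>M \<mu>))"
      by (subst integral_distr, simp, simp) (simp only: cos_eq[OF m1] cos_eq[OF m2] char_rot)
  qed (simp_all add: sets2 borel_prod)
qed

text \<open>Linearity makes the componentwise embedding \<open>J\<close> commute with
  \<open>rotate45\<close>, and injectivity makes \<open>A \<times> B\<close> the preimage under
  \<open>J\<close> of the rectangle of images. Both sides can therefore be computed on
  \<open>H\<close>.\<close>

lemma distr_rotate45_subspace:
  fixes \<mu> :: "'h::{real_inner, complete_space, second_countable_topology} measure"
    and j :: "'x::{banach, second_countable_topology} \<Rightarrow> 'h"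
  assumes "centred_gaussian C \<mu>" and j: "bounded_linear j" "inj j" and full: "emeasure \<mu> (range j) = 1"
    and AB: "A \<in> sets borel" "B \<in> sets borel"
  defines "\<nu> \<equiv> measure_on_subspace j \<mu>"
  shows "emeasure (\<nu> \<Otimes>\<^sub>M \<nu>) (rotate45 -` (A \<times> B)) = emeasure \<nu> A * emeasure \<nu> B"
proof -
  interpret j: bounded_linear j by fact
  have sets [measurable_cong]: "sets \<mu> = sets borel" and "prob_space \<mu>"
    using assms by (auto simp: centred_gaussian_def)
  interpret \<mu>: prob_space \<mu> by fact
  interpret e: borel_embedding \<mu> j
    using full j sets \<open>prob_space \<mu>\<close>
    by unfold_locales (auto intro: linear_continuous_on)
  have sets_\<nu> [measurable_cong]: "sets \<nu> = sets borel" unfolding \<nu>_def by simp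
  interpret \<nu>: prob_space \<nu> unfolding \<nu>_def by (rule e.prob_M)
  have [measurable]: "j \<in> borel_measurable borel"
    by (intro borel_measurable_continuous_onI linear_continuous_on j)
  define J where "J = (\<lambda>z. (j (fst z), j (snd z)))"
  have J [measurable]: "J \<in> \<nu> \<Otimes>\<^sub>M \<nu> \<rightarrow>\<^sub>M \<mu> \<Otimes>\<^sub>M \<mu>" unfolding J_def by measurable
  have "distr \<nu> borel j = \<mu>" unfolding \<nu>_def by (rule e.distr_M)
  then have distr: "distr \<nu> \<mu> j = \<mu>" by (simp add: sets cong: distr_cong)
  have "\<mu> \<Otimes>\<^sub>M \<mu> = distr (\<nu> \<Otimes>\<^sub>M \<nu>) (\<mu> \<Otimes>\<^sub>M \<mu>) (\<lambda>(x, y). (j x, j y))"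
    using pair_measure_distr[of j \<nu> \<mu> j \<nu> \<mu>] distr \<mu>.sigma_finite_measure_axioms by simp
  then have distr_J: "distr (\<nu> \<Otimes>\<^sub>M \<nu>) (\<mu> \<Otimes>\<^sub>M \<mu>) J = \<mu> \<Otimes>\<^sub>M \<mu>"
    by (simp add: J_def case_prod_unfold)
  have jA: "j ` A \<in> sets \<mu>" "j ` B \<in> sets \<mu>"
    using AB by (auto simp: sets e.image_borel)
  have J_rotate: "J (rotate45 z) = rotate45 (J z)" for z
    by (simp add: J_def rotate45_def j.scaleR j.add j.diff)
  have jA2: "j ` A \<times> j ` B \<in> sets (borel \<Otimes>\<^sub>M borel)" using jA by (simp add: sets)
  have rot_sets: "rotate45 -` (j ` A \<times> j ` B) \<in> sets (\<mu> \<Otimes>\<^sub>M \<mu>)"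
    using measurable_sets[OF borel_measurable_rotate45 jA2] sets_pair_measure_cong[OF sets sets]
    by (simp add: space_pair_measure)
  have "rotate45 -` (A \<times> B) = J -` (rotate45 -` (j ` A \<times> j ` B))"
  proof (rule set_eqI)
    fix z
    have "J w \<in> j ` A \<times> j ` B \<longleftrightarrow> w \<in> A \<times> B" for w
      using j(2) by (cases w) (simp add: J_def inj_image_mem_iff)
    then show "z \<in> rotate45 -` (A \<times> B) \<longleftrightarrow> z \<in> J -` (rotate45 -` (j ` A \<times> j ` B))"
      by (simp only: vimage_eq J_rotate[symmetric])
  qed
  then have "emeasure (\<nu> \<Otimes>\<^sub>M \<nu>) (rotate45 -` (A \<times> B)) = emeasure (distr (\<nu> \<Otimes>\<^sub>M \<nu>) (\<mu> \<Otimes>\<^sub>M \<mu>) J) (rotate45 -` (j ` A \<times> j ` B))"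
    using rot_sets sets_eq_imp_space_eq[OF sets_\<nu>] by (simp add: emeasure_distr space_pair_measure)
  also have "\<dots> = emeasure (distr (\<mu> \<Otimes>\<^sub>M \<mu>) (borel \<Otimes>\<^sub>M borel) rotate45) (j ` A \<times> j ` B)"
    using jA2 sets_eq_imp_space_eq[OF sets] by (simp add: distr_J emeasure_distr space_pair_measure)
  also have "\<dots> = emeasure \<mu> (j ` A) * emeasure \<mu> (j ` B)"
    using jA by (simp add: distr_rotate45_gaussian[OF assms(1)] \<mu>.emeasure_pair_measure_Times)
  also have "\<dots> = emeasure \<nu> A * emeasure \<nu> B"
    using AB by (simp add: \<nu>_def e.emeasure_M)
  finally show ?thesis .
qed

section \<open>Tail estimates and exponential moments under rotation invariance\<close>

locale rotation_invariant = prob_space \<nu>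
  for \<nu> :: "'x::{banach, second_countable_topology} measure" +
  assumes sets_\<nu> [measurable_cong]: "sets \<nu> = sets borel"
    and rotate: "\<And>A B. A \<in> sets borel \<Longrightarrow> B \<in> sets borel \<Longrightarrow>
      emeasure (\<nu> \<Otimes>\<^sub>M \<nu>) (rotate45 -` (A \<times> B)) = emeasure \<nu> A * emeasure \<nu> B"
begin

abbreviation tail :: "real \<Rightarrow> real" where "tail t \<equiv> prob {x. t < norm x}"

lemma space_\<nu>: "space \<nu> = UNIV"
  using sets_eq_imp_space_eq[OF sets_\<nu>] by simp

lemma tail_antimono: "s \<le> t \<Longrightarrow> tail t \<le> tail s"
  by (intro finite_measure_mono) (auto simp: sets_\<nu>)

lemma prob_norm_le: "prob {x. norm x \<le> s} = 1 - tail s"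
proof -
  have "{x. norm x \<le> s} = space \<nu> - {x. s < norm x}" by (auto simp: space_\<nu>)
  then show ?thesis by (simp only: prob_compl) (simp add: prob_compl sets_\<nu>)
qed

text \<open>From \<open>x + y = 2x - (x - y) = 2y + (x - y)\<close>, a large sum together with a
  small difference forces both \<open>norm x\<close> and \<open>norm y\<close> above
  \<open>(t - s) / sqrt 2\<close>. By \<open>rotate\<close> the left side is the probability of the
  first event, and the right side is that of the second.\<close>

lemma tail_square_bound: "(1 - tail s) * tail t \<le> (tail ((t - s) / sqrt 2))\<^sup>2"
proof -
  let ?r = "(t - s) / sqrt 2"
  have "emeasure \<nu> {x. t < norm x} * emeasure \<nu> {x. norm x \<le> s} =
    emeasure (\<nu> \<Otimes>\<^sub>M \<nu>) (rotate45 -` ({x. t < norm x} \<times> {x. norm x \<le> s}))"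
    by (rule rotate[symmetric]) auto
  also have "\<dots> \<le> emeasure (\<nu> \<Otimes>\<^sub>M \<nu>) ({x. ?r < norm x} \<times> {x. ?r < norm x})"
  proof (rule emeasure_mono)
    show "{x. ?r < norm x} \<times> {x. ?r < norm x} \<in> sets (\<nu> \<Otimes>\<^sub>M \<nu>)"
      by (intro pair_measureI) (auto simp: sets_\<nu>)
    show "(rotate45 :: 'x \<times> 'x \<Rightarrow> _) -` ({x. t < norm x} \<times> {x. norm x \<le> s}) \<subseteq> {x. ?r < norm x} \<times> {x. ?r < norm x}"
    proof
      fix z :: "'x \<times> 'x" assume z: "z \<in> rotate45 -` ({x. t < norm x} \<times> {x. norm x \<le> s})"
      obtain x y where xy: "z = (x, y)" by force
      have "sqrt 2 * t < norm (x + y)" "norm (x - y) \<le> sqrt 2 * s"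
        using z by (auto simp: xy rotate45_def pos_less_divide_eq pos_divide_le_eq mult.commute)
      moreover have "norm (x + y) \<le> norm (2 *\<^sub>R x) + norm (x - y)"
        using norm_triangle_ineq4[of "2 *\<^sub>R x" "x - y"] by (simp add: scaleR_2)
      moreover have "norm (x + y) \<le> norm (2 *\<^sub>R y) + norm (x - y)"
        using norm_triangle_ineq[of "2 *\<^sub>R y" "x - y"] by (simp add: scaleR_2 add.commute)
      ultimately have "sqrt 2 * (t - s) < 2 * norm x" "sqrt 2 * (t - s) < 2 * norm y"
        by (simp_all add: algebra_simps)
      moreover have "2 * ?r = sqrt 2 * (t - s)" by (simp add: field_simps)
      ultimately have "?r < norm x" "?r < norm y" by linarith+
      then show "z \<in> {x. ?r < norm x} \<times> {x. ?r < norm x}" by (simp add: xy)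
    qed
  qed
  also have "\<dots> = emeasure \<nu> {x. ?r < norm x} * emeasure \<nu> {x. ?r < norm x}"
    by (intro emeasure_pair_measure_Times) (auto simp: sets_\<nu>)
  finally have "tail t * prob {x. norm x \<le> s} \<le> tail ?r * tail ?r"
    by (simp add: emeasure_eq_measure ennreal_mult[symmetric])
  then show ?thesis by (simp add: prob_norm_le power2_eq_square mult.commute)
qed

lemma exists_small_tail: "\<exists>s>0. tail s \<le> 1/4"
proof -
  have "(\<lambda>n. prob {x. real n < norm x}) \<longlonglongrightarrow> prob (\<Inter>n. {x. real n < norm x})"
    by (intro finite_Lim_measure_decseq) (auto simp: sets_\<nu> decseq_def)
  also have "(\<Inter>n. {x::'x. real n < norm x}) = {}"
  proof -
    have "\<exists>n. \<not> real n < norm x" for x :: 'x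
      using reals_Archimedean2[of "norm x"] by (auto simp: not_less intro: less_imp_le)
    then show ?thesis by auto
  qed
  finally have "(\<lambda>n. tail (real n)) \<longlonglongrightarrow> 0" by simp
  then have "\<forall>\<^sub>F n in sequentially. tail (real n) < 1/4"
    by (rule order_tendstoD) simp
  then obtain N where "\<And>n. n \<ge> N \<Longrightarrow> tail (real n) < 1/4" unfolding eventually_sequentially by blast
  from this[of "Suc N"] show ?thesis by (intro exI[of _ "real (Suc N)"]) auto
qed

text \<open>
  The radii \<open>t n = s * (4 * sqrt 2 ^ n - 3)\<close> satisfy \<open>t n \<le> (t (Suc n) - s) / sqrt 2\<close>, so each step squares
  the tail, while \<open>(t n)\<^sup>2\<close> only doubles up to constants.
\<close>

lemma tail_iterated_bound:
  assumes "s > 0" "tail s \<le> 1/4"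
  shows "tail (s * (4 * sqrt 2 ^ n - 3)) \<le> (1/3) ^ 2 ^ n"
proof -
  \<comment> \<open>The factor \<open>3/4\<close> is the lower bound for \<open>1 - tail s\<close>
    and makes the induction close: squaring gives \<open>9/16\<close>, and dividing by
    \<open>3/4\<close> restores \<open>3/4\<close>. At \<open>n = 0\<close> the bound is
    \<open>3/4 * 1/3 = 1/4\<close>, which is where \<open>1/3\<close> comes from.\<close>
  have "tail (s * (4 * sqrt 2 ^ n - 3)) \<le> 3/4 * (1/3) ^ 2 ^ n" for n
  proof (induction n)
    case 0
    then show ?case using assms by simp
  next
    case (Suc n)
    let ?t = "\<lambda>n. s * (4 * sqrt 2 ^ n - 3)"
    \<comment> \<open>The offset 3 in the radii is chosen for this: multiplied by
      \<open>sqrt 2\<close> it is at least 4, which is the offset 3 plus the \<open>s\<close>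
      subtracted at the next radius.\<close>
    have "4 / 3 \<le> sqrt (2::real)" by (rule real_le_rsqrt) (simp add: power2_eq_square)
    then have "sqrt 2 * ?t n \<le> ?t (Suc n) - s"
      using assms(1) by (simp add: algebra_simps)
    then have "?t n \<le> (?t (Suc n) - s) / sqrt 2"
      by (simp add: field_simps)
    then have "tail ((?t (Suc n) - s) / sqrt 2) \<le> tail (?t n)" by (rule tail_antimono)
    then have "(tail ((?t (Suc n) - s) / sqrt 2))\<^sup>2 \<le> (3/4 * (1/3) ^ 2 ^ n)\<^sup>2"
      using Suc.IH by (intro power_mono) auto
    then have "(1 - tail s) * tail (?t (Suc n)) \<le> (3/4 * (1/3) ^ 2 ^ n)\<^sup>2"
      using tail_square_bound[of s "?t (Suc n)"] by linarith
    moreover have "3/4 * tail (?t (Suc n)) \<le> (1 - tail s) * tail (?t (Suc n))"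
      using assms(2) by (intro mult_right_mono) auto
    moreover have "(3/4 * (1/3) ^ 2 ^ n)\<^sup>2 = 9/16 * (1/3 :: real) ^ 2 ^ Suc n"
      by (simp add: power_mult_distrib power_even_eq power2_eq_square flip: power_mult)
    ultimately show ?case by simp
  qed
  from this[of n] show ?thesis
    using zero_le_power[of "1/3 :: real" "2 ^ n"] by linarith
qed

text \<open>Outside the ball of radius \<open>s\<close> the space is cut into shells between
  \<open>t n\<close> and \<open>t (Suc n)\<close>. On a shell the integrand is at most
  \<open>(3/2) ^ 2 ^ n\<close>, while its probability is at most \<open>(1/3) ^ 2 ^ n\<close>; the
  products \<open>(1/2) ^ 2 ^ n\<close> are summable.\<close>

theorem fernique: "\<exists>a>0. integrable \<nu> (\<lambda>x. exp (a * (norm x)\<^sup>2))"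
proof -
  obtain s where s: "s > 0" "tail s \<le> 1/4" using exists_small_tail by blast
  define t where "t = (\<lambda>n::nat. s * (4 * sqrt 2 ^ n - 3))"
  \<comment> \<open>The radii satisfy
    \<open>(t (Suc n))\<^sup>2 \<le> 32 * s\<^sup>2 * 2 ^ n\<close>, so this \<open>a\<close> keeps
    the exponential on a shell below \<open>(3/2) ^ 2 ^ n\<close>. The base \<open>3/2\<close> is a
    choice between 1 and 3, the reciprocal of the tail base.\<close>
  define a where "a = ln (3/2) / (32 * s\<^sup>2)"
  have "a > 0" using s by (simp add: a_def)
  have t_Suc: "a * (t (Suc n))\<^sup>2 \<le> ln (3/2) * 2 ^ n" for n
  proof -
    have "0 \<le> t (Suc n)" "t (Suc n) \<le> s * (4 * sqrt 2 ^ Suc n)"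
      using s one_le_power[of "sqrt 2" "Suc n"] by (auto simp: t_def)
    then have "(t (Suc n))\<^sup>2 \<le> (s * (4 * sqrt 2 ^ Suc n))\<^sup>2" by (intro power_mono)
    also have "\<dots> = 32 * s\<^sup>2 * 2 ^ n"
    proof -
      have "(sqrt 2 ^ k)\<^sup>2 = (sqrt 2 ^ 2) ^ k" for k by (simp only: mult.commute flip: power_mult)
      then show ?thesis by (simp add: power_mult_distrib)
    qed
    finally have "a * (t (Suc n))\<^sup>2 \<le> a * (32 * s\<^sup>2 * 2 ^ n)"
      using \<open>a > 0\<close> by simp
    then show ?thesis using s by (simp add: a_def)
  qed
  have t_unbounded: "\<exists>n. r \<le> t n" for r
  proof -
    have "1 < sqrt (2::real)" by simp
    then obtain n where "r / s + 3 < sqrt 2 ^ n" using real_arch_pow by blast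
    moreover have "sqrt 2 ^ n \<le> 4 * sqrt 2 ^ n" by simp
    ultimately have "r / s \<le> 4 * sqrt 2 ^ n - 3" by linarith
    then show ?thesis using s by (intro exI[of _ n]) (simp add: t_def field_simps)
  qed
  have pointwise: "ennreal (exp (a * (norm x)\<^sup>2)) \<le> ennreal (exp (a * s\<^sup>2)) +
      (\<Sum>n. ennreal (exp (ln (3/2) * 2 ^ n)) * indicator {x. t n < norm x} x)" for x :: 'x
  proof (cases "norm x \<le> s")
    case True
    then have "ennreal (exp (a * (norm x)\<^sup>2)) \<le> ennreal (exp (a * s\<^sup>2))"
      using \<open>a > 0\<close> by (intro ennreal_leI) (simp add: power_mono)
    then show ?thesis by (rule order_trans) simp
  next
    case False
    define m where "m = (LEAST n. norm x \<le> t n)"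
    have m: "norm x \<le> t m" unfolding m_def using t_unbounded by (rule LeastI_ex)
    \<comment> \<open>The first radius is \<open>t 0 = s\<close>, and \<open>norm x\<close> exceeds
      it.\<close>
    have "m \<noteq> 0" using m False by (intro notI) (simp add: t_def)
    then obtain n where n: "m = Suc n" using not0_implies_Suc by blast
    have "t n < norm x" using not_less_Least[of n "\<lambda>n. norm x \<le> t n"] n by (simp add: m_def not_le)
    have "a * (norm x)\<^sup>2 \<le> a * (t (Suc n))\<^sup>2"
      using m n \<open>a > 0\<close> by (simp add: power_mono)
    then have "a * (norm x)\<^sup>2 \<le> ln (3/2) * 2 ^ n" using t_Suc[of n] by linarith
    then have "ennreal (exp (a * (norm x)\<^sup>2)) \<le> ennreal (exp (ln (3/2) * 2 ^ n)) * indicator {x. t n < norm x} x"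
      using \<open>t n < norm x\<close> by (simp add: ennreal_leI)
    also have "\<dots> \<le> (\<Sum>n. ennreal (exp (ln (3/2) * 2 ^ n)) * indicator {x. t n < norm x} x)"
      (is "?f n \<le> suminf ?f")
    proof -
      have "sum ?f {n} \<le> suminf ?f" by (intro sum_le_suminf) auto
      then show ?thesis by (subst (asm) sum.insert) auto
    qed
    finally show ?thesis by (rule order_trans) simp
  qed
  have summand_le: "ennreal (exp (ln (3/2) * 2 ^ n)) * emeasure \<nu> {x. t n < norm x} \<le> ennreal ((1/2) ^ n)" for n
  proof -
    have "exp (ln (3/2) * 2 ^ n) = (3/2 :: real) ^ 2 ^ n"
      by (metis exp_ln exp_of_nat2_mult half_gt_zero_iff mult.commute of_nat_numeral of_nat_power zero_less_numeral)
    then have "exp (ln (3/2) * 2 ^ n) * tail (t n) \<le> (3/2) ^ 2 ^ n * (1/3) ^ 2 ^ n"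
      using tail_iterated_bound[OF s, of n] by (simp add: t_def)
    also have "\<dots> = (1/2 :: real) ^ 2 ^ n" by (simp flip: power_mult_distrib)
    also have "\<dots> \<le> (1/2) ^ n"
      by (rule power_decreasing) (auto simp: less_imp_le)
    finally show ?thesis by (simp add: emeasure_eq_measure ennreal_mult[symmetric] ennreal_leI)
  qed
  have "(\<integral>\<^sup>+x. ennreal (exp (a * (norm x)\<^sup>2)) \<partial>\<nu>) \<le> (\<integral>\<^sup>+x. ennreal (exp (a * s\<^sup>2)) +
      (\<Sum>n. ennreal (exp (ln (3/2) * 2 ^ n)) * indicator {x. t n < norm x} x) \<partial>\<nu>)"
    by (intro nn_integral_mono pointwise)
  also have "\<dots> = ennreal (exp (a * s\<^sup>2)) + (\<Sum>n. ennreal (exp (ln (3/2) * 2 ^ n)) * emeasure \<nu> {x. t n < norm x})"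
    by (subst nn_integral_add) (auto simp: nn_integral_suminf nn_integral_cmult_indicator sets_\<nu> emeasure_space_1)
  also have "\<dots> \<le> ennreal (exp (a * s\<^sup>2)) + (\<Sum>n. ennreal ((1/2) ^ n))"
    by (intro add_left_mono suminf_le summand_le) auto
  also have "\<dots> < \<infinity>"
    by (subst suminf_ennreal2) (auto simp: summable_geometric)
  finally have "integrable \<nu> (\<lambda>x. exp (a * (norm x)\<^sup>2))"
    by (intro integrableI_bounded) auto
  then show ?thesis using \<open>a > 0\<close> by blast
qed

end

section \<open>Convergence of posteriors\<close>

text \<open>\<open>RN_deriv\<close> is some version of the density, so it can be identified only
  almost everywhere. Total mass 1 provides the sigma-finiteness behind that uniqueness.\<close>

lemma (in prob_space) hellinger_dist_density:
  assumes [measurable]: "f \<in> borel_measurable M" "g \<in> borel_measurable M"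
    and nn: "\<And>x. 0 \<le> f x" "\<And>x. 0 \<le> g x"
    and prob: "prob_space (density M (\<lambda>x. ennreal (f x)))" "prob_space (density M (\<lambda>x. ennreal (g x)))"
  shows "hellinger_dist M (density M (\<lambda>x. ennreal (f x))) (density M (\<lambda>x. ennreal (g x))) =
    sqrt (1 / 2 * (\<integral>x. (sqrt (f x) - sqrt (g x))\<^sup>2 \<partial>M))"
proof -
  have RN: "AE x in M. enn2real (RN_deriv M (density M (\<lambda>x. ennreal (h x))) x) = h x"
    if [measurable]: "h \<in> borel_measurable M" and "\<And>x. 0 \<le> h x"
      and prob: "prob_space (density M (\<lambda>x. ennreal (h x)))" for h
  proof -
    interpret P: prob_space "density M (\<lambda>x. ennreal (h x))" by fact
    have "AE x in M. ennreal (h x) = RN_deriv M (density M (\<lambda>x. ennreal (h x))) x"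
      by (rule RN_deriv_unique_sigma_finite) (auto intro: P.sigma_finite_measure_axioms)
    then show ?thesis
      by eventually_elim (metis enn2real_ennreal that(2))
  qed
  have "(\<integral>x. (sqrt (enn2real (RN_deriv M (density M (\<lambda>x. ennreal (f x))) x)) -
      sqrt (enn2real (RN_deriv M (density M (\<lambda>x. ennreal (g x))) x)))\<^sup>2 \<partial>M) =
    (\<integral>x. (sqrt (f x) - sqrt (g x))\<^sup>2 \<partial>M)"
  proof (rule integral_cong_AE)
    show "AE x in M. (sqrt (enn2real (RN_deriv M (density M (\<lambda>x. ennreal (f x))) x)) -
        sqrt (enn2real (RN_deriv M (density M (\<lambda>x. ennreal (g x))) x)))\<^sup>2 = (sqrt (f x) - sqrt (g x))\<^sup>2"
      using RN[OF assms(1) nn(1) prob(1)] RN[OF assms(2) nn(2) prob(2)] by eventually_elim simp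
  qed measurable
  then show ?thesis by (simp add: hellinger_dist_def)
qed

text \<open>The usual order is reversed: the norm is given with its triangle inequality, and
  expanding \<open>(norm (u + v))\<^sup>2\<close> turns the latter into Cauchy-Schwarz.\<close>

lemma inner_product_of_norm_cauchy_schwarz:
  assumes "inner_product_of_norm ip"
  shows "\<bar>ip u v\<bar> \<le> norm u * norm v"
proof -
  have lin: "linear (ip u)" and sym: "ip u v = ip v u" and sq: "ip u u = (norm u)\<^sup>2" for u v
    using assms by (auto simp: inner_product_of_norm_def)
  have expand: "(norm (u + v))\<^sup>2 = (norm u)\<^sup>2 + 2 * ip u v + (norm v)\<^sup>2" for u v
    using sym[of "u + v" u] sym[of "u + v" v] sym[of v u]
    by (simp add: sq[symmetric] linear_add[OF lin])
  have upper: "ip u v \<le> norm u * norm v" for u v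
  proof -
    have "(norm (u + v))\<^sup>2 \<le> (norm u + norm v)\<^sup>2"
      by (intro power_mono norm_triangle_ineq) auto
    then show ?thesis by (simp add: expand power2_sum)
  qed
  show ?thesis
    using upper[of u v] upper[of u "- v"] linear_neg[OF lin, of u v] by (simp add: abs_le_iff)
qed

lemma power_le_fact_exp:
  fixes y :: real
  assumes "0 \<le> y"
  shows "y ^ m \<le> fact m * exp y"
proof -
  have "sum (\<lambda>n. y ^ n /\<^sub>R fact n) {m} \<le> (\<Sum>n. y ^ n /\<^sub>R fact n)"
    using assms by (intro sum_le_suminf sums_summable[OF exp_converges]) auto
  then have "y ^ m / fact m \<le> exp y"
    by (simp add: exp_def divide_inverse mult.commute)
  then show ?thesis by (simp add: divide_le_eq mult.commute)
qed

lemma inner_product_of_norm_bounded_linear: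
  assumes "inner_product_of_norm ip"
  shows "bounded_linear (ip u)" "bounded_linear (\<lambda>u. ip u v)"
proof -
  have lin: "linear (ip u)" and sym: "ip u v = ip v u" for u v
    using assms by (auto simp: inner_product_of_norm_def)
  have bl: "bounded_linear (ip u)" for u
    using lin[of u] inner_product_of_norm_cauchy_schwarz[OF assms, of u]
    by (intro bounded_linear_intro[where K = "norm u"]) (auto simp: linear_add linear_scale mult.commute)
  then show "bounded_linear (ip u)" .
  have "(\<lambda>u. ip u v) = ip v" using sym by auto
  then show "bounded_linear (\<lambda>u. ip u v)" using bl by simp
qed

text \<open>Centring makes the integrand depend on the measure through its mean. In the uncentred
  form all measures share one integrand, to which \<open>norm_integral_diff_le\<close> applies, and
  the means enter only through a rank-one term.\<close>

lemma covariance_op_eq: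
  fixes Q :: "'x::{banach, second_countable_topology} measure"
  assumes ip: "inner_product_of_norm ip" and "prob_space Q" and sets [measurable_cong]: "sets Q = sets borel"
    and int1: "integrable Q (\<lambda>u. u)" and int2: "integrable Q (\<lambda>u. (norm u)\<^sup>2)"
  shows "integrable Q (\<lambda>u. ip u v *\<^sub>R u)"
    and "covariance_op ip Q v = (\<integral>u. ip u v *\<^sub>R u \<partial>Q) - ip (mean Q) v *\<^sub>R mean Q"
proof -
  interpret prob_space Q by fact
  interpret L: bounded_linear "\<lambda>u. ip u v" by (rule inner_product_of_norm_bounded_linear[OF ip])
  have [measurable]: "(\<lambda>u. ip u v) \<in> borel_measurable borel"
    by (intro borel_measurable_continuous_onI linear_continuous_on L.bounded_linear_axioms)
  show int_ip: "integrable Q (\<lambda>u. ip u v *\<^sub>R u)"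
  proof (rule Bochner_Integration.integrable_bound)
    show "integrable Q (\<lambda>u. norm v * (norm u)\<^sup>2)" using int2 by simp
    have "norm (ip u v *\<^sub>R u) \<le> norm v * (norm u)\<^sup>2" for u
      using mult_right_mono[OF inner_product_of_norm_cauchy_schwarz[OF ip, of u v], of "norm u"]
      by (simp add: power2_eq_square mult_ac)
    then show "AE u in Q. norm (ip u v *\<^sub>R u) \<le> norm (norm v * (norm u)\<^sup>2)" by simp
  qed simp
  have int_L: "integrable Q (\<lambda>u. ip u v)" and L_mean: "(\<integral>u. ip u v \<partial>Q) = ip (mean Q) v"
    using integrable_bounded_linear[OF L.bounded_linear_axioms int1] integral_bounded_linear[OF L.bounded_linear_axioms int1]
    by (simp_all add: mean_def)
  let ?m = "mean Q"
  have "covariance_op ip Q v = (\<integral>u. ip u v *\<^sub>R u - ip u v *\<^sub>R ?m - (ip ?m v *\<^sub>R u - ip ?m v *\<^sub>R ?m) \<partial>Q)"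
    unfolding covariance_op_def by (simp add: L.diff algebra_simps)
  also have "\<dots> = (\<integral>u. ip u v *\<^sub>R u \<partial>Q) - (\<integral>u. ip u v \<partial>Q) *\<^sub>R ?m - (ip ?m v *\<^sub>R (\<integral>u. u \<partial>Q) - ip ?m v *\<^sub>R ?m)"
    using int_ip int_L int1 by (simp add: prob_space)
  finally show "covariance_op ip Q v = (\<integral>u. ip u v *\<^sub>R u \<partial>Q) - ip ?m v *\<^sub>R ?m"
    by (simp add: L_mean mean_def)
qed

text \<open>Boundedness is what gives \<open>onorm\<close>, a supremum over all vectors, its meaning
  as operator norm. The constant adds the second moment and the square of the norm of the mean, one
  for each term of the uncentred form.\<close>

lemma bounded_linear_covariance_op:
  fixes Q :: "'x::{banach, second_countable_topology} measure"
  assumes ip: "inner_product_of_norm ip" and "prob_space Q" and sets: "sets Q = sets borel"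
    and int1: "integrable Q (\<lambda>u. u)" and int2: "integrable Q (\<lambda>u. (norm u)\<^sup>2)"
  shows "bounded_linear (covariance_op ip Q)"
proof (rule bounded_linear_intro[where K = "(\<integral>u. (norm u)\<^sup>2 \<partial>Q) + (norm (mean Q))\<^sup>2"])
  note eq = covariance_op_eq[OF assms]
  interpret L: bounded_linear "ip u" for u by (rule inner_product_of_norm_bounded_linear[OF ip])
  fix v w :: 'x and r :: real
  show "covariance_op ip Q (v + w) = covariance_op ip Q v + covariance_op ip Q w"
    using eq(1)[of v] eq(1)[of w] by (simp add: eq(2) L.add scaleR_add_left)
  show "covariance_op ip Q (r *\<^sub>R v) = r *\<^sub>R covariance_op ip Q v"
    by (simp add: eq(2) L.scaleR scaleR_diff_right flip: scaleR_scaleR)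
  have bound: "norm (ip u v *\<^sub>R u) \<le> norm v * (norm u)\<^sup>2" for u
    using mult_right_mono[OF inner_product_of_norm_cauchy_schwarz[OF ip, of u v], of "norm u"]
    by (simp add: power2_eq_square mult_ac)
  have "norm (\<integral>u. ip u v *\<^sub>R u \<partial>Q) \<le> (\<integral>u. norm v * (norm u)\<^sup>2 \<partial>Q)"
  proof -
    have "norm (\<integral>u. ip u v *\<^sub>R u \<partial>Q) \<le> (\<integral>u. norm (ip u v *\<^sub>R u) \<partial>Q)" by (rule integral_norm_bound)
    also have "\<dots> \<le> (\<integral>u. norm v * (norm u)\<^sup>2 \<partial>Q)"
      using eq(1)[of v] int2 bound by (intro integral_mono) (simp_all del: norm_scaleR)
    finally show ?thesis .
  qed
  then have "norm (\<integral>u. ip u v *\<^sub>R u \<partial>Q) \<le> norm v * (\<integral>u. (norm u)\<^sup>2 \<partial>Q)"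
    by simp
  then show "norm (covariance_op ip Q v) \<le> norm v * ((\<integral>u. (norm u)\<^sup>2 \<partial>Q) + (norm (mean Q))\<^sup>2)"
    using bound[of "mean Q"] norm_triangle_ineq4[of "\<integral>u. ip u v *\<^sub>R u \<partial>Q" "ip (mean Q) v *\<^sub>R mean Q"]
    by (simp only: eq(2) distrib_left)
qed

section \<open>Dominated convergence of the posterior densities\<close>

locale posterior_approximation = prob_space \<mu>0
  for \<mu>0 :: "'x::{banach, second_countable_topology} measure" +
  fixes \<Phi> :: "'x \<Rightarrow> real" and \<Phi>N :: "nat \<Rightarrow> 'x \<Rightarrow> real" and a M :: real
  assumes sets_\<mu>0 [measurable_cong]: "sets \<mu>0 = sets borel"
    and measurable_\<Phi> [measurable]: "\<Phi> \<in> borel_measurable borel" "\<And>N. \<Phi>N N \<in> borel_measurable borel"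
    and a: "a > 0" and exp_moment: "integrable \<mu>0 (\<lambda>u. exp (a * (norm u)\<^sup>2))"
    and lower: "\<And>u. \<Phi> u \<ge> M - a / 2 * (norm u)\<^sup>2" "\<And>u N. \<Phi>N N u \<ge> M - a / 2 * (norm u)\<^sup>2"
    and pointwise: "\<And>u. (\<lambda>N. \<Phi>N N u) \<longlonglongrightarrow> \<Phi> u"
begin

abbreviation "Z \<equiv> normalising_constant \<mu>0 \<Phi>"
abbreviation "ZN N \<equiv> normalising_constant \<mu>0 (\<Phi>N N)"
definition "dens u = 1 / Z * exp (- \<Phi> u)"
definition "densN N u = 1 / ZN N * exp (- \<Phi>N N u)"

text \<open>The admissible weights: \<open>exp (a / 2 * (norm u)\<^sup>2 - M)\<close> bounds all the
  unnormalised densities at once, so \<open>q\<close> times it is one integrable envelope for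
  dominated convergence, independent of \<open>N\<close>.\<close>

definition dominates :: "('x \<Rightarrow> real) \<Rightarrow> bool" where
  "dominates q \<longleftrightarrow> q \<in> borel_measurable borel \<and> (\<forall>u. 0 \<le> q u) \<and>
     integrable \<mu>0 (\<lambda>u. q u * exp (a / 2 * (norm u)\<^sup>2 - M))"

lemma exp_le: "exp (- \<Phi> u) \<le> exp (a / 2 * (norm u)\<^sup>2 - M)" "exp (- \<Phi>N N u) \<le> exp (a / 2 * (norm u)\<^sup>2 - M)"
  using lower(1)[of u] lower(2)[where u = u and N = N] by simp_all

lemma dominates_mult_integrable:
  assumes "dominates q" "w \<in> borel_measurable borel" "\<And>u. 0 \<le> w u" "\<And>u. w u \<le> exp (a / 2 * (norm u)\<^sup>2 - M)"
  shows "integrable \<mu>0 (\<lambda>u. q u * w u)"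
proof (rule Bochner_Integration.integrable_bound)
  show "integrable \<mu>0 (\<lambda>u. q u * exp (a / 2 * (norm u)\<^sup>2 - M))" using assms by (simp add: dominates_def)
  show "(\<lambda>u. q u * w u) \<in> borel_measurable \<mu>0" using assms by (auto simp: dominates_def)
  show "AE u in \<mu>0. norm (q u * w u) \<le> norm (q u * exp (a / 2 * (norm u)\<^sup>2 - M))"
    using assms by (auto simp: dominates_def abs_mult intro!: AE_I2 mult_left_mono)
qed

text \<open>The power is at most \<open>1 + norm u ^ (2 * m)\<close>. The even exponent makes the
  last term a multiple of \<open>y ^ m\<close> with \<open>y = a / 2 * (norm u)\<^sup>2\<close>,
  which one term of the exponential series bounds by \<open>fact m * exp y\<close>. This uses up the
  second half of the exponent \<open>a\<close>.\<close>

lemma dominates_norm_powr: "p \<ge> 0 \<Longrightarrow> dominates (\<lambda>u. norm u powr p)"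
  unfolding dominates_def
proof (intro conjI allI)
  assume "p \<ge> 0"
  obtain m :: nat where m: "p \<le> real (2 * m)"
  proof -
    obtain m :: nat where "p \<le> real m" using real_arch_simple by blast
    then show thesis by (intro that[of m]) simp
  qed
  define K where "K = 1 + fact m / (a / 2) ^ m"
  have bound: "norm u powr p \<le> K * exp (a / 2 * (norm u)\<^sup>2)" for u :: 'x
  proof -
    let ?y = "a / 2 * (norm u)\<^sup>2"
    have "norm u powr p \<le> 1 + norm u ^ (2 * m)"
    proof (cases "norm u \<le> 1")
      case True
      then have "norm u powr p \<le> 1" using \<open>p \<ge> 0\<close> powr_le1[of p "norm u"] by simp
      then show ?thesis by (simp add: add_increasing2)
    next
      case False
      then have "norm u powr p \<le> norm u powr real (2 * m)" using m by (intro powr_mono) auto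
      also have "\<dots> = norm u ^ (2 * m)" using False by (subst powr_realpow) auto
      finally show ?thesis by simp
    qed
    also have "norm u ^ (2 * m) = ?y ^ m / (a / 2) ^ m"
    proof -
      have "(a / 2) ^ m \<noteq> 0" using a by simp
      moreover have "?y ^ m = (a / 2) ^ m * norm u ^ (2 * m)" by (simp only: power_mult power_mult_distrib)
      ultimately show ?thesis by (metis nonzero_mult_div_cancel_left)
    qed
    also have "?y ^ m / (a / 2) ^ m \<le> (fact m * exp ?y) / (a / 2) ^ m"
      using a power_le_fact_exp[of ?y m] by (intro divide_right_mono) auto
    also have "1 + (fact m * exp ?y) / (a / 2) ^ m \<le> exp ?y + (fact m * exp ?y) / (a / 2) ^ m"
      using a by simp
    finally show ?thesis by (simp add: K_def algebra_simps)
  qed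
  show "integrable \<mu>0 (\<lambda>u. norm u powr p * exp (a / 2 * (norm u)\<^sup>2 - M))"
  proof (rule Bochner_Integration.integrable_bound)
    show "integrable \<mu>0 (\<lambda>u. K * exp (- M) * exp (a * (norm u)\<^sup>2))"
      using exp_moment by simp
    show "AE u in \<mu>0. norm (norm u powr p * exp (a / 2 * (norm u)\<^sup>2 - M)) \<le> norm (K * exp (- M) * exp (a * (norm u)\<^sup>2))"
    proof (rule AE_I2)
      fix u :: 'x
      have "norm u powr p * exp (a / 2 * (norm u)\<^sup>2 - M) \<le> (K * exp (a / 2 * (norm u)\<^sup>2)) * exp (a / 2 * (norm u)\<^sup>2 - M)"
        by (intro mult_right_mono bound) auto
      also have "\<dots> = K * exp (- M) * exp (a * (norm u)\<^sup>2)"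
        by (simp add: mult.assoc flip: exp_add)
      finally show "norm (norm u powr p * exp (a / 2 * (norm u)\<^sup>2 - M)) \<le> norm (K * exp (- M) * exp (a * (norm u)\<^sup>2))"
        using abs_ge_self by (simp add: order_trans)
    qed
  qed auto
qed auto

lemma dominates_norm: "dominates norm"
  using dominates_norm_powr[of 1] by simp

lemma dominates_norm_square: "dominates (\<lambda>u. (norm u)\<^sup>2)"
  using dominates_norm_powr[of 2] by simp

text \<open>Not the case \<open>p = 0\<close> of the powers of the norm, because
  \<open>0 powr 0 = 0\<close>.\<close>

lemma dominates_const: "dominates (\<lambda>_. 1)"
proof -
  have "integrable \<mu>0 (\<lambda>u. exp (- M) * exp (a * (norm u)\<^sup>2))" using exp_moment by simp
  then have "integrable \<mu>0 (\<lambda>u. exp (a / 2 * (norm u)\<^sup>2 - M))"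
  proof (rule Bochner_Integration.integrable_bound)
    show "AE u in \<mu>0. norm (exp (a / 2 * (norm u)\<^sup>2 - M)) \<le> norm (exp (- M) * exp (a * (norm u)\<^sup>2))"
      using a by (auto intro!: AE_I2 simp: mult_right_mono simp flip: exp_add)
  qed simp
  then show ?thesis by (simp add: dominates_def)
qed

lemma tendsto_integral_weight:
  assumes q: "dominates q"
  shows "(\<lambda>N. \<integral>u. q u * exp (- \<Phi>N N u) \<partial>\<mu>0) \<longlonglongrightarrow> (\<integral>u. q u * exp (- \<Phi> u) \<partial>\<mu>0)"
proof (rule integral_dominated_convergence[where w = "\<lambda>u. q u * exp (a / 2 * (norm u)\<^sup>2 - M)"])
  have [measurable]: "q \<in> borel_measurable borel" using q by (simp add: dominates_def)
  show "(\<lambda>u. q u * exp (- \<Phi> u)) \<in> borel_measurable \<mu>0" "(\<lambda>u. q u * exp (- \<Phi>N N u)) \<in> borel_measurable \<mu>0" for N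
    by measurable
  show "integrable \<mu>0 (\<lambda>u. q u * exp (a / 2 * (norm u)\<^sup>2 - M))" using q by (simp add: dominates_def)
  show "AE u in \<mu>0. (\<lambda>N. q u * exp (- \<Phi>N N u)) \<longlonglongrightarrow> q u * exp (- \<Phi> u)"
    by (intro AE_I2 tendsto_intros pointwise)
  show "AE u in \<mu>0. norm (q u * exp (- \<Phi>N N u)) \<le> q u * exp (a / 2 * (norm u)\<^sup>2 - M)" for N
    using q exp_le(2) by (auto intro!: AE_I2 mult_left_mono simp: dominates_def abs_mult)
qed

lemma integrable_weight:
  assumes "dominates q"
  shows "integrable \<mu>0 (\<lambda>u. q u * exp (- \<Phi> u))" "integrable \<mu>0 (\<lambda>u. q u * exp (- \<Phi>N N u))"
  by (intro dominates_mult_integrable[OF assms] exp_le; simp)+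

text \<open>An integrable positive function with integral 0 would vanish almost everywhere, which a
  probability space excludes.\<close>

lemma normalising_constant_pos: "0 < Z" "0 < ZN N"
proof -
  have pos: "0 < (\<integral>u. exp (\<phi> u) \<partial>\<mu>0)" if "integrable \<mu>0 (\<lambda>u. exp (\<phi> u))" for \<phi> :: "'x \<Rightarrow> real"
  proof -
    have "(\<integral>u. exp (\<phi> u) \<partial>\<mu>0) \<noteq> 0"
      using integral_nonneg_eq_0_iff_AE[OF that] AE_False by auto
    moreover have "0 \<le> (\<integral>u. exp (\<phi> u) \<partial>\<mu>0)" by (intro integral_nonneg_AE) auto
    ultimately show ?thesis by linarith
  qed
  show "0 < Z" "0 < ZN N"
    using integrable_weight[OF dominates_const] by (auto simp: normalising_constant_def intro!: pos)
qed

lemma tendsto_ZN: "ZN \<longlonglongrightarrow> Z"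
  using tendsto_integral_weight[OF dominates_const] by (simp add: normalising_constant_def)

lemma measurable_dens [measurable]: "dens \<in> borel_measurable borel" "densN N \<in> borel_measurable borel"
  unfolding dens_def[abs_def] densN_def[abs_def] by measurable

lemma dens_pos: "0 < dens u" "0 < densN N u"
  using normalising_constant_pos by (auto simp: dens_def densN_def)

lemma tendsto_densN: "(\<lambda>N. densN N u) \<longlonglongrightarrow> dens u"
  unfolding dens_def densN_def using normalising_constant_pos
  by (intro tendsto_intros tendsto_ZN pointwise) auto

lemma posterior_eq: "posterior \<mu>0 \<Phi> = density \<mu>0 (\<lambda>u. ennreal (dens u))"
  "posterior \<mu>0 (\<Phi>N N) = density \<mu>0 (\<lambda>u. ennreal (densN N u))"
  by (simp_all add: posterior_def dens_def densN_def)

lemma integrable_dens: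
  assumes "dominates q"
  shows "integrable \<mu>0 (\<lambda>u. q u * dens u)" "integrable \<mu>0 (\<lambda>u. q u * densN N u)"
  using integrable_weight[OF assms] by (simp_all add: dens_def densN_def mult.left_commute)

lemma integral_dens: "(\<integral>u. dens u \<partial>\<mu>0) = 1" "(\<integral>u. densN N u \<partial>\<mu>0) = 1"
  using normalising_constant_pos(1) normalising_constant_pos(2)[of N] by (simp_all add: dens_def densN_def flip: normalising_constant_def)

lemma prob_space_posterior: "prob_space (posterior \<mu>0 \<Phi>)" "prob_space (posterior \<mu>0 (\<Phi>N N))"
proof -
  have "prob_space (density \<mu>0 (\<lambda>u. ennreal (g u)))"
    if [measurable]: "g \<in> borel_measurable borel" and "\<And>u. 0 < g u" "integrable \<mu>0 g" "(\<integral>u. g u \<partial>\<mu>0) = 1" for g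
    using that(2-) by (intro prob_spaceI) (simp add: emeasure_density nn_integral_eq_integral less_imp_le)
  then show "prob_space (posterior \<mu>0 \<Phi>)" "prob_space (posterior \<mu>0 (\<Phi>N N))"
    unfolding posterior_eq using integrable_dens[OF dominates_const] dens_pos integral_dens by simp_all
qed

lemma tendsto_weighted_L1:
  assumes q: "dominates q"
  shows "(\<lambda>N. \<integral>u. q u * \<bar>densN N u - dens u\<bar> \<partial>\<mu>0) \<longlonglongrightarrow> 0"
proof -
  \<comment> \<open>The envelope must not depend on \<open>N\<close>, so the factors
    \<open>1 / ZN N\<close> need a common bound; they converge, since the limit \<open>Z\<close> is
    positive.\<close>
  have "Bseq (\<lambda>N. 1 / ZN N)"
    using normalising_constant_pos by (intro convergent_imp_Bseq convergentI[of _ "1 / Z"] tendsto_intros tendsto_ZN) auto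
  then obtain K where K: "K > 0" "\<And>N. 1 / ZN N \<le> K"
    using normalising_constant_pos(2) by (auto simp: Bseq_def) (metis abs_of_pos)
  have "(\<lambda>N. \<integral>u. q u * \<bar>densN N u - dens u\<bar> \<partial>\<mu>0) \<longlonglongrightarrow> (\<integral>u. 0 \<partial>\<mu>0)"
  proof (rule integral_dominated_convergence[where w = "\<lambda>u. (K + 1 / Z) * (q u * exp (a / 2 * (norm u)\<^sup>2 - M))"])
    have [measurable]: "q \<in> borel_measurable borel" using q by (simp add: dominates_def)
    show "(\<lambda>u. q u * \<bar>densN N u - dens u\<bar>) \<in> borel_measurable \<mu>0" for N by measurable
    show "integrable \<mu>0 (\<lambda>u. (K + 1 / Z) * (q u * exp (a / 2 * (norm u)\<^sup>2 - M)))"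
      using q by (simp add: dominates_def)
    show "AE u in \<mu>0. (\<lambda>N. q u * \<bar>densN N u - dens u\<bar>) \<longlonglongrightarrow> 0"
      by (intro AE_I2 tendsto_mult_right_zero tendsto_rabs_zero LIM_zero tendsto_densN)
    show "AE u in \<mu>0. norm (q u * \<bar>densN N u - dens u\<bar>) \<le> (K + 1 / Z) * (q u * exp (a / 2 * (norm u)\<^sup>2 - M))" for N
    proof (rule AE_I2)
      fix u :: 'x
      let ?e = "exp (a / 2 * (norm u)\<^sup>2 - M)"
      have "densN N u \<le> K * ?e"
        unfolding densN_def using K exp_le(2) by (intro mult_mono) auto
      moreover have "dens u \<le> 1 / Z * ?e"
        unfolding dens_def using normalising_constant_pos exp_le(1) by (intro mult_left_mono) auto
      ultimately have "\<bar>densN N u - dens u\<bar> \<le> (K + 1 / Z) * ?e"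
        using dens_pos(1)[of u] dens_pos(2)[where u = u and N = N] by (simp add: distrib_right abs_le_iff)
      then have "q u * \<bar>densN N u - dens u\<bar> \<le> q u * ((K + 1 / Z) * ?e)"
        using q by (intro mult_left_mono) (auto simp: dominates_def)
      then show "norm (q u * \<bar>densN N u - dens u\<bar>) \<le> (K + 1 / Z) * (q u * ?e)"
        using q by (simp add: dominates_def abs_mult mult.left_commute)
    qed
  qed simp
  then show ?thesis by simp
qed

lemma hellinger_tendsto: "(\<lambda>N. hellinger_dist \<mu>0 (posterior \<mu>0 \<Phi>) (posterior \<mu>0 (\<Phi>N N))) \<longlonglongrightarrow> 0"
proof -
  have bound: "(\<integral>u. (sqrt (dens u) - sqrt (densN N u))\<^sup>2 \<partial>\<mu>0) \<le> (\<integral>u. \<bar>densN N u - dens u\<bar> \<partial>\<mu>0)" for N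
  proof (rule integral_mono')
    show "integrable \<mu>0 (\<lambda>u. \<bar>densN N u - dens u\<bar>)"
      using integrable_dens[OF dominates_const] by simp
    fix u :: 'x
    have "(sqrt (dens u) - sqrt (densN N u))\<^sup>2 = \<bar>sqrt (dens u) - sqrt (densN N u)\<bar> * \<bar>sqrt (dens u) - sqrt (densN N u)\<bar>"
      by (simp add: power2_eq_square)
    also have "\<dots> \<le> \<bar>sqrt (dens u) - sqrt (densN N u)\<bar> * \<bar>sqrt (dens u) + sqrt (densN N u)\<bar>"
    proof -
      have "0 < sqrt (dens u)" "0 < sqrt (densN N u)" using dens_pos by simp_all
      then show ?thesis by (intro mult_left_mono) (simp_all add: abs_le_iff)
    qed
    also have "\<dots> = \<bar>densN N u - dens u\<bar>"
    proof -
      have "(sqrt (dens u) - sqrt (densN N u)) * (sqrt (dens u) + sqrt (densN N u)) = dens u - densN N u"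
        using dens_pos(1)[of u] dens_pos(2)[where u = u and N = N] by (simp add: algebra_simps)
      then show ?thesis by (simp add: abs_minus_commute flip: abs_mult)
    qed
    finally show "(sqrt (dens u) - sqrt (densN N u))\<^sup>2 \<le> \<bar>densN N u - dens u\<bar>" .
  qed simp
  have L1: "(\<lambda>N. \<integral>u. \<bar>densN N u - dens u\<bar> \<partial>\<mu>0) \<longlonglongrightarrow> 0"
    using tendsto_weighted_L1[OF dominates_const] by simp
  have "(\<lambda>N. \<integral>u. (sqrt (dens u) - sqrt (densN N u))\<^sup>2 \<partial>\<mu>0) \<longlonglongrightarrow> 0"
    by (rule tendsto_sandwich[OF _ _ tendsto_const L1]) (auto intro!: always_eventually bound)
  then have "(\<lambda>N. sqrt (1 / 2 * (\<integral>u. (sqrt (dens u) - sqrt (densN N u))\<^sup>2 \<partial>\<mu>0))) \<longlonglongrightarrow> sqrt (1 / 2 * 0)"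
    by (intro tendsto_intros)
  moreover have "hellinger_dist \<mu>0 (posterior \<mu>0 \<Phi>) (posterior \<mu>0 (\<Phi>N N)) =
      sqrt (1 / 2 * (\<integral>u. (sqrt (dens u) - sqrt (densN N u))\<^sup>2 \<partial>\<mu>0))" for N
    using prob_space_posterior(1) prob_space_posterior(2)[of N] unfolding posterior_eq
    by (intro hellinger_dist_density) (auto simp: dens_pos less_imp_le)
  ultimately show ?thesis by simp
qed

lemma integrable_posterior:
  fixes g :: "'x \<Rightarrow> 'b::{banach, second_countable_topology}"
  assumes [measurable]: "g \<in> borel_measurable borel" and "dominates q" "\<And>u. norm (g u) \<le> q u"
  shows "integrable (posterior \<mu>0 \<Phi>) g" "integrable (posterior \<mu>0 (\<Phi>N N)) g"
    "integrable \<mu>0 (\<lambda>u. dens u *\<^sub>R g u)" "integrable \<mu>0 (\<lambda>u. densN N u *\<^sub>R g u)"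
proof -
  have i: "integrable \<mu>0 (\<lambda>u. h u *\<^sub>R g u)"
    if [measurable]: "h \<in> borel_measurable borel" and "integrable \<mu>0 (\<lambda>u. q u * h u)" "\<And>u. 0 < h u" for h
    using that(2)
  proof (rule Bochner_Integration.integrable_bound)
    have "norm (h u *\<^sub>R g u) \<le> norm (q u * h u)" for u
    proof -
      have "h u * norm (g u) \<le> h u * q u" using that(3)[of u] assms(3) by (intro mult_left_mono) (auto simp: less_imp_le)
      also have "\<dots> \<le> norm (q u * h u)" using abs_ge_self[of "q u * h u"] by (simp add: mult.commute)
      finally show ?thesis using that(3)[of u] by simp
    qed
    then show "AE u in \<mu>0. norm (h u *\<^sub>R g u) \<le> norm (q u * h u)" by simp
  qed simp
  show 1: "integrable \<mu>0 (\<lambda>u. dens u *\<^sub>R g u)" and 2: "integrable \<mu>0 (\<lambda>u. densN N u *\<^sub>R g u)"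
    using integrable_dens[OF assms(2)] dens_pos by (auto intro!: i)
  show "integrable (posterior \<mu>0 \<Phi>) g" "integrable (posterior \<mu>0 (\<Phi>N N)) g"
    unfolding posterior_eq using 1 2 dens_pos by (subst integrable_density; auto simp: less_imp_le)+
qed

text \<open>An explicit bound and not just a limit: for the covariance, \<open>g\<close> depends on
  a direction \<open>v\<close>, and the choice \<open>q u = norm v * (norm u)\<^sup>2\<close> makes
  the estimate uniform over the unit ball.\<close>

lemma norm_integral_diff_le:
  fixes g :: "'x \<Rightarrow> 'b::{banach, second_countable_topology}"
  assumes [measurable]: "g \<in> borel_measurable borel" and q: "dominates q" "\<And>u. norm (g u) \<le> q u"
  shows "norm ((\<integral>u. g u \<partial>posterior \<mu>0 (\<Phi>N N)) - (\<integral>u. g u \<partial>posterior \<mu>0 \<Phi>)) \<le> (\<integral>u. q u * \<bar>densN N u - dens u\<bar> \<partial>\<mu>0)"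
proof -
  note i = integrable_posterior[OF assms]
  have "(\<integral>u. g u \<partial>posterior \<mu>0 (\<Phi>N N)) - (\<integral>u. g u \<partial>posterior \<mu>0 \<Phi>) =
      (\<integral>u. densN N u *\<^sub>R g u \<partial>\<mu>0) - (\<integral>u. dens u *\<^sub>R g u \<partial>\<mu>0)"
    unfolding posterior_eq using dens_pos by (simp add: integral_density less_imp_le)
  also have "\<dots> = (\<integral>u. (densN N u - dens u) *\<^sub>R g u \<partial>\<mu>0)"
    using i by (simp add: scaleR_diff_left)
  also have "norm \<dots> \<le> (\<integral>u. norm ((densN N u - dens u) *\<^sub>R g u) \<partial>\<mu>0)" by (rule integral_norm_bound)
  also have "\<dots> \<le> (\<integral>u. q u * \<bar>densN N u - dens u\<bar> \<partial>\<mu>0)"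
  proof (rule integral_mono')
    have "integrable \<mu>0 (\<lambda>u. \<bar>q u * densN N u - q u * dens u\<bar>)" using integrable_dens[OF q(1)] by simp
    moreover have "\<bar>q u * densN N u - q u * dens u\<bar> = q u * \<bar>densN N u - dens u\<bar>" for u
      using q(1) by (simp add: dominates_def abs_mult flip: right_diff_distrib)
    ultimately show "integrable \<mu>0 (\<lambda>u. q u * \<bar>densN N u - dens u\<bar>)" by simp
  qed (use q in \<open>auto simp: mult.commute dominates_def intro: mult_right_mono\<close>)
  finally show ?thesis .
qed

lemma tendsto_integral_posterior:
  fixes g :: "'x \<Rightarrow> 'b::{banach, second_countable_topology}"
  assumes "g \<in> borel_measurable borel" "dominates q" "\<And>u. norm (g u) \<le> q u"
  shows "(\<lambda>N. \<integral>u. g u \<partial>posterior \<mu>0 (\<Phi>N N)) \<longlonglongrightarrow> (\<integral>u. g u \<partial>posterior \<mu>0 \<Phi>)"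
  by (rule LIM_zero_cancel, rule tendsto_norm_zero_cancel,
      rule tendsto_sandwich[OF _ _ tendsto_const tendsto_weighted_L1[OF assms(2)]])
     (auto intro!: always_eventually norm_integral_diff_le assms)

lemma dominates_cmult: "dominates q \<Longrightarrow> 0 \<le> c \<Longrightarrow> dominates (\<lambda>u. c * q u)"
  by (auto simp: dominates_def mult.assoc)

lemma sets_posterior: "sets (posterior \<mu>0 \<Phi>) = sets borel" "sets (posterior \<mu>0 (\<Phi>N N)) = sets borel"
  by (simp_all add: posterior_def sets_\<mu>0)

lemma mean_tendsto: "(\<lambda>N. mean (posterior \<mu>0 (\<Phi>N N))) \<longlonglongrightarrow> mean (posterior \<mu>0 \<Phi>)"
  unfolding mean_def by (rule tendsto_integral_posterior[OF _ dominates_norm]) auto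

lemma integrable_posterior_id_square:
  "integrable (posterior \<mu>0 \<Phi>) (\<lambda>u. u)" "integrable (posterior \<mu>0 (\<Phi>N N)) (\<lambda>u. u)"
  "integrable (posterior \<mu>0 \<Phi>) (\<lambda>u. (norm u)\<^sup>2)" "integrable (posterior \<mu>0 (\<Phi>N N)) (\<lambda>u. (norm u)\<^sup>2)"
  by (rule integrable_posterior[OF _ dominates_norm] integrable_posterior[OF _ dominates_norm_square]; simp)+

lemma covariance_op_posterior:
  assumes "inner_product_of_norm ip"
  shows "bounded_linear (covariance_op ip (posterior \<mu>0 \<Phi>))"
    "bounded_linear (covariance_op ip (posterior \<mu>0 (\<Phi>N N)))"
  by (rule bounded_linear_covariance_op[OF assms]; fact prob_space_posterior sets_posterior integrable_posterior_id_square)+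

lemma covariance_op_tendsto:
  assumes ip: "inner_product_of_norm ip"
  shows "(\<lambda>N. onorm (\<lambda>v. covariance_op ip (posterior \<mu>0 (\<Phi>N N)) v - covariance_op ip (posterior \<mu>0 \<Phi>) v)) \<longlonglongrightarrow> 0"
proof -
  let ?P = "posterior \<mu>0 \<Phi>" and ?PN = "\<lambda>N. posterior \<mu>0 (\<Phi>N N)"
  let ?m = "mean ?P" and ?mN = "\<lambda>N. mean (?PN N)"
  define L where "L = (\<lambda>N. \<integral>u. (norm u)\<^sup>2 * \<bar>densN N u - dens u\<bar> \<partial>\<mu>0)"
  \<comment> \<open>\<open>L N\<close> controls the second-moment operators. The other summand
    controls the rank-one terms, whose difference telescopes into \<open>ip (?mN N) v *\<^sub>R (?mN
    N - ?m) + ip (?mN N - ?m) v *\<^sub>R ?m\<close>.\<close>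
  define B where "B = (\<lambda>N. L N + norm (?mN N - ?m) * (norm (?mN N) + norm ?m))"
  have "L \<longlonglongrightarrow> 0" unfolding L_def by (rule tendsto_weighted_L1[OF dominates_norm_square])
  then have "B \<longlonglongrightarrow> 0 + norm (?m - ?m) * (norm ?m + norm ?m)"
    unfolding B_def by (intro tendsto_intros mean_tendsto)
  then have B0: "B \<longlonglongrightarrow> 0" by simp
  have cs: "\<bar>ip u v\<bar> \<le> norm u * norm v" for u v by (rule inner_product_of_norm_cauchy_schwarz[OF ip])
  have diff: "norm (covariance_op ip (?PN N) v - covariance_op ip ?P v) \<le> B N * norm v" for N v
  proof -
    interpret R: bounded_linear "\<lambda>u. ip u v" by (rule inner_product_of_norm_bounded_linear[OF ip])
    have [measurable]: "(\<lambda>u. ip u v) \<in> borel_measurable borel"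
      by (intro borel_measurable_continuous_onI linear_continuous_on R.bounded_linear_axioms)
    have "norm (ip u v *\<^sub>R u) \<le> norm v * (norm u)\<^sup>2" for u
      using mult_right_mono[OF cs[of u v], of "norm u"] by (simp add: power2_eq_square mult_ac)
    then have "norm ((\<integral>u. ip u v *\<^sub>R u \<partial>?PN N) - (\<integral>u. ip u v *\<^sub>R u \<partial>?P)) \<le> (\<integral>u. norm v * (norm u)\<^sup>2 * \<bar>densN N u - dens u\<bar> \<partial>\<mu>0)"
      by (intro norm_integral_diff_le dominates_cmult dominates_norm_square) auto
    then have S: "norm ((\<integral>u. ip u v *\<^sub>R u \<partial>?PN N) - (\<integral>u. ip u v *\<^sub>R u \<partial>?P)) \<le> norm v * L N"
      by (simp add: L_def mult.assoc)
    have mean_bound: "norm (ip (?mN N) v *\<^sub>R (?mN N - ?m) + ip (?mN N - ?m) v *\<^sub>R ?m) \<le>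
        norm (?mN N) * norm v * norm (?mN N - ?m) + norm (?mN N - ?m) * norm v * norm ?m"
      by (rule norm_triangle_le) (auto intro!: add_mono mult_right_mono cs)
    have eq: "covariance_op ip (?PN N) v - covariance_op ip ?P v =
        ((\<integral>u. ip u v *\<^sub>R u \<partial>?PN N) - (\<integral>u. ip u v *\<^sub>R u \<partial>?P)) -
        (ip (?mN N) v *\<^sub>R (?mN N - ?m) + ip (?mN N - ?m) v *\<^sub>R ?m)"
      by (simp add: covariance_op_eq(2)[OF ip] prob_space_posterior sets_posterior integrable_posterior_id_square
          R.diff scaleR_diff_left scaleR_diff_right)
    have "norm (covariance_op ip (?PN N) v - covariance_op ip ?P v) \<le> norm v * L N +
        (norm (?mN N) * norm v * norm (?mN N - ?m) + norm (?mN N - ?m) * norm v * norm ?m)"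
      unfolding eq using S mean_bound norm_triangle_ineq4[of "(\<integral>u. ip u v *\<^sub>R u \<partial>?PN N) - (\<integral>u. ip u v *\<^sub>R u \<partial>?P)"
          "ip (?mN N) v *\<^sub>R (?mN N - ?m) + ip (?mN N - ?m) v *\<^sub>R ?m"]
      by linarith
    also have "\<dots> = B N * norm v" by (simp add: B_def algebra_simps)
    finally show ?thesis .
  qed
  have B_nonneg: "0 \<le> B N" for N
    unfolding B_def L_def by (intro add_nonneg_nonneg mult_nonneg_nonneg integral_nonneg_AE) auto
  have "bounded_linear (\<lambda>v. covariance_op ip (?PN N) v - covariance_op ip ?P v)" for N
    by (intro bounded_linear_sub covariance_op_posterior ip)
  then have "0 \<le> onorm (\<lambda>v. covariance_op ip (?PN N) v - covariance_op ip ?P v)" for N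
    by (rule onorm_pos_le)
  moreover have "onorm (\<lambda>v. covariance_op ip (?PN N) v - covariance_op ip ?P v) \<le> B N" for N
    by (rule onorm_bound[OF B_nonneg diff])
  ultimately show ?thesis
    by (intro tendsto_sandwich[OF _ _ tendsto_const B0]) (auto intro!: always_eventually)
qed

end

theorem theorem2p6:
  fixes C :: "'h :: {real_inner, complete_space, second_countable_topology} \<Rightarrow> 'h"
    and \<mu>H :: "'h measure"
    and j :: "'x :: {banach, second_countable_topology} \<Rightarrow> 'h"
    and \<mu>0 \<mu> :: "'x measure"
    and \<mu>N :: "nat \<Rightarrow> 'x measure"
    and \<Phi> :: "'x \<Rightarrow> real"
    and \<Phi>N :: "nat \<Rightarrow> 'x \<Rightarrow> real"
    and \<psi> :: "nat \<Rightarrow> real"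
  assumes gaussian: "centred_gaussian C \<mu>H"
    and embedding: "bounded_linear j" "inj j"
    and full: "emeasure \<mu>H (range j) = 1"
    and \<mu>0: "\<mu>0 = measure_on_subspace j \<mu>H"
    and measurable: "\<Phi> \<in> borel_measurable borel" "\<And>N. \<Phi>N N \<in> borel_measurable borel"
    and lower: "\<And>\<epsilon>. \<epsilon> > 0 \<Longrightarrow>
      \<exists>M. \<forall>u N. \<Phi> u \<ge> M - \<epsilon> * (norm u)\<^sup>2 \<and> \<Phi>N N u \<ge> M - \<epsilon> * (norm u)\<^sup>2"
    and upper: "\<And>r. r > 0 \<Longrightarrow>
      \<exists>L>0. \<forall>u N. norm u < r \<longrightarrow> \<Phi> u \<le> L \<and> \<Phi>N N u \<le> L"
    and approx: "\<And>R. R > 0 \<Longrightarrow>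
      \<exists>K>0. \<forall>u N. norm u \<le> R \<longrightarrow> \<bar>\<Phi> u - \<Phi>N N u\<bar> \<le> K * \<psi> N"
    and \<psi>: "\<psi> \<longlonglongrightarrow> 0"
    and \<mu>: "\<mu> = posterior \<mu>0 \<Phi>"
    and \<mu>N: "\<And>N. \<mu>N N = posterior \<mu>0 (\<Phi>N N)"
  shows "prob_space \<mu> \<and> (\<forall>N. prob_space (\<mu>N N)) \<and>
    (\<lambda>N. hellinger_dist \<mu>0 \<mu> (\<mu>N N)) \<longlonglongrightarrow> 0 \<and>
    (\<forall>p>0. integrable \<mu> (\<lambda>u. norm u powr p) \<and>
           (\<forall>N. integrable (\<mu>N N) (\<lambda>u. norm u powr p)) \<and>
           (\<lambda>N. \<integral>u. norm u powr p \<partial>(\<mu>N N)) \<longlonglongrightarrow> (\<integral>u. norm u powr p \<partial>\<mu>)) \<and>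
    (\<lambda>N. mean (\<mu>N N)) \<longlonglongrightarrow> mean \<mu> \<and>
    (\<forall>ip. inner_product_of_norm ip \<longrightarrow>
       bounded_linear (covariance_op ip \<mu>) \<and>
       (\<forall>N. bounded_linear (covariance_op ip (\<mu>N N))) \<and>
       (\<lambda>N. onorm (\<lambda>v. covariance_op ip (\<mu>N N) v - covariance_op ip \<mu> v)) \<longlonglongrightarrow> 0)"
proof -
  have "prob_space \<mu>H" "sets \<mu>H = sets borel"
    using centred_gaussianD[OF gaussian] by simp_all
  then interpret embedding: borel_embedding \<mu>H j
    using linear_continuous_on[OF embedding(1)] embedding(2) full by (rule borel_embedding.intro)
  interpret rotation_invariant \<mu>0
  proof (intro rotation_invariant.intro rotation_invariant_axioms.intro)
    show "prob_space \<mu>0" unfolding \<mu>0 by (rule embedding.prob_M)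
    show "sets \<mu>0 = sets borel" unfolding \<mu>0 by simp
    show "emeasure (\<mu>0 \<Otimes>\<^sub>M \<mu>0) (rotate45 -` (A \<times> B)) = emeasure \<mu>0 A * emeasure \<mu>0 B"
      if "A \<in> sets borel" "B \<in> sets borel" for A B
      unfolding \<mu>0 using that by (rule distr_rotate45_subspace[OF gaussian embedding full])
  qed
  obtain a where a: "a > 0" "integrable \<mu>0 (\<lambda>u. exp (a * (norm u)\<^sup>2))" using fernique by blast
  \<comment> \<open>Half the Fernique exponent, so that \<open>exp (- \<Phi> u)\<close> stays
    integrable against every power of the norm.\<close>
  obtain M where M: "\<And>u N. \<Phi> u \<ge> M - a / 2 * (norm u)\<^sup>2 \<and> \<Phi>N N u \<ge> M - a / 2 * (norm u)\<^sup>2"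
    using lower[OF half_gt_zero[OF a(1)]] by blast
  interpret posterior_approximation \<mu>0 \<Phi> \<Phi>N a M
  proof unfold_locales
    fix u :: 'x
    \<comment> \<open>The added 1 keeps the radius positive at \<open>u = 0\<close>.\<close>
    obtain K where K: "\<And>v N. norm v \<le> norm u + 1 \<Longrightarrow> \<bar>\<Phi> v - \<Phi>N N v\<bar> \<le> K * \<psi> N"
      using approx[OF add_nonneg_pos[OF norm_ge_zero zero_less_one], of u] by blast
    have "(\<lambda>N. K * \<psi> N) \<longlonglongrightarrow> 0" using \<psi> by (rule tendsto_mult_right_zero)
    moreover have "\<forall>\<^sub>F N in sequentially. norm (\<Phi>N N u - \<Phi> u) \<le> K * \<psi> N"
      using K[of u] by (simp add: abs_minus_commute)
    ultimately have "(\<lambda>N. \<Phi>N N u - \<Phi> u) \<longlonglongrightarrow> 0" by (rule Lim_null_comparison[rotated])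
    then show "(\<lambda>N. \<Phi>N N u) \<longlonglongrightarrow> \<Phi> u" by (rule LIM_zero_cancel)
  next
    show "\<Phi> u \<ge> M - a / 2 * (norm u)\<^sup>2" "\<Phi>N N u \<ge> M - a / 2 * (norm u)\<^sup>2" for u N
      using M[of u N] by blast+
  qed (fact a sets_\<nu> measurable)+
  show ?thesis
    unfolding \<mu> \<mu>N
  proof (intro conjI allI impI)
    fix p :: real and N assume "p > 0"
    then have p: "dominates (\<lambda>u. norm u powr p)" by (intro dominates_norm_powr) simp
    show "integrable (posterior \<mu>0 \<Phi>) (\<lambda>u. norm u powr p)" "integrable (posterior \<mu>0 (\<Phi>N N)) (\<lambda>u. norm u powr p)"
      by (rule integrable_posterior[OF _ p]; simp)+
    show "(\<lambda>N. \<integral>u. norm u powr p \<partial>posterior \<mu>0 (\<Phi>N N)) \<longlonglongrightarrow> (\<integral>u. norm u powr p \<partial>posterior \<mu>0 \<Phi>)"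
      by (rule tendsto_integral_posterior[OF _ p]; simp)
  next
    fix ip :: "'x \<Rightarrow> 'x \<Rightarrow> real" and N assume ip: "inner_product_of_norm ip"
    show "bounded_linear (covariance_op ip (posterior \<mu>0 \<Phi>))" "bounded_linear (covariance_op ip (posterior \<mu>0 (\<Phi>N N)))"
      using covariance_op_posterior[OF ip] by blast+
    show "(\<lambda>N. onorm (\<lambda>v. covariance_op ip (posterior \<mu>0 (\<Phi>N N)) v - covariance_op ip (posterior \<mu>0 \<Phi>) v)) \<longlonglongrightarrow> 0"
      by (rule covariance_op_tendsto[OF ip])
  qed (rule prob_space_posterior hellinger_tendsto mean_tendsto)+
qed

end
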